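(* Let $k\in\mathbb{N}$ and let $\mathcal{R}_1$ and $\mathcal{R}_2$ be rules of the same order $k$. The following are equivalent. (A1) For all $J\in\mathcal{J}_k$ we have $q_{J,\mathcal{R}_1}=q_{J,\mathcal{R}_2}$. (A2) $\Phi_{\mathcal{R}_1}=\Phi_{\mathcal{R}_2}$ as functions $\mathcal{W}_0\times[0,\infty)\to\mathcal{W}_0$.
   Context: $\mathbb{N}$ is the set of positive integers and $[k]=\{1,\dots,k\}$. Graphs are finite, simple and undirected. $\mathbb{I}_{\{\cdot\}}$ denotes an indicator. Rules. For $k\in\mathbb{N}$, $\mathcal{H}_k$ is the set of all labelled graphs on vertex set $[k]$. A rule of order $k$ is a matrix $\mathcal{R}=(\mathcal{R}_{F,H})_{F,H\in\mathcal{H}_k}\in[0,1]^{\mathcal{H}_k\times\mathcal{H}_k}$ such that $\sum_{H\in\mathcal{H}_k}\mathcal{R}_{F,H}=1$ for every $F\in\mathcal{H}_k$. Rooted graphs. $\mathcal{G}_k=\mathcal{H}_k\times\{(a,b)\in[k]^2:a\neq b\}$; its element $(F,(a,b))$ is written $F^{a,b}$. Two elements $F^{a,b},G^{c,d}\in\mathcal{G}_k$ are isomorphic if there is a bijection $\phi:[k]\to[k]$ with $uv\in E(F)\iff\phi(u)\phi(v)\in E(G)$ for all $u,v$, $\phi(a)=c$ and $\phi(b)=d$. $\mathcal{J}_k$ is the set of isomorphism classes of $\mathcal{G}_k$. (For $k=1$ these sets are empty.) For $J\in\mathcal{J}_k$ and a rule $\mathcal{R}$ of order $k$, $$q_{J,\mathcal{R}}=\sum_{F^{a,b}\in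 J}\Big(\sum_{H\in\mathcal{H}_k}\mathcal{R}_{F,H}\cdot\mathbb{I}_{\{ab\in E(H)\}}-\mathbb{I}_{\{ab\in E(F)\}}\Big).$$ Kernels and graphons. $(\Omega,\pi)$ is a fixed atomless probability space with a separable sigma-algebra. $\mathcal{W}\subseteq L^\infty(\Omega^2)$ is the set of kernels, i.e. bounded symmetric measurable real-valued functions on $\Omega^2$, with the norm $\|\cdot\|_\infty$. $\mathcal{W}_0\subseteq\mathcal{W}$ is the set of graphons, i.e. kernels with values in $[0,1]$. Velocity and trajectories. For $F^{a,b}\in\mathcal{G}_k$ and $W\in\mathcal{W}$, $$T_{F^{a,b}}W(x,y)=\int\prod_{ij\in E(F)}W(x_i,x_j)\prod_{ij\notin E(F)}(1-W(x_i,x_j))\,\mathrm{d}\pi^{[k]\setminus\{a,b\}},$$ where the products are over unordered pairs $ij$ of distinct vertices in $[k]$, $x_a=x$ and $x_b=y$ are fixed, and the integral is over $(x_i)_{i\in[k]\setminus\{a,b\}}$. The velocity operator of a rule $\mathcal{R}$ of order $k$ is $\mathfrak{V}_{\mathcal{R}}:\mathcal{W}\to\mathcal{W}$, $$\mathfrak{V}_{\mathcal{R}}W=\sum_{F^{a,b}\in\mathcal{G}_k}\Big(\sum_{H\in\mathcal{H}_k}\mathcal{R}_{F,H}\mathbb{I}_{\{ab\in E(H)\}}-\mathbb{I}_{\{ab\in E(F)\}}\Big)T_{F^{a,b}}W.$$ For a rule $\mathcal{R}$, $\Phi_{\mathcal{R}}:\mathcal{W}_0\times[0,\infty)\to\mathcal{W}_0$,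 $(W,t)\mapsto\Phi_{\mathcal{R}}^tW$, is the function such that for each $W\in\mathcal{W}_0$, $t\mapsto\Phi^t_{\mathcal{R}}W$ is the unique solution in $(\mathcal{W},\|\cdot\|_\infty)$ of $\frac{\mathrm{d}}{\mathrm{d}t}\Phi^t_{\mathcal{R}}W=\mathfrak{V}_{\mathcal{R}}\Phi^t_{\mathcal{R}}W$ with $\Phi^0_{\mathcal{R}}W=W$ (it is known that this solution exists, is unique and stays in $\mathcal{W}_0$ for all $t\ge0$). *)

theory Defs
  imports "HOL-Probability.Probability" "HOL-Library.Ramsey"
begin

text \<open>A simple graph on \<open>{1..k}\<close> is represented by its edge set, a set of two-element
  subsets of \<open>{1..k}\<close>.\<close>

definition labelled_graphs :: "nat \<Rightarrow> nat set set set" where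
  "labelled_graphs k = Pow (nsets {1..k} 2)"

text \<open>Only the entries of a rule that are indexed by labelled graphs on \<open>{1..k}\<close> are
  constrained or ever used.\<close>

definition is_rule :: "nat \<Rightarrow> (nat set set \<Rightarrow> nat set set \<Rightarrow> real) \<Rightarrow> bool" where
  "is_rule k R \<longleftrightarrow>
     (\<forall>F\<in>labelled_graphs k. \<forall>H\<in>labelled_graphs k. 0 \<le> R F H \<and> R F H \<le> 1) \<and>
     (\<forall>F\<in>labelled_graphs k. (\<Sum>H\<in>labelled_graphs k. R F H) = 1)"

definition rooted_graphs :: "nat \<Rightarrow> (nat set set \<times> nat \<times> nat) set" where
  "rooted_graphs k = labelled_graphs k \<times> {(a, b) \<in> {1..k} \<times> {1..k}. a \<noteq> b}"

definition rooted_iso ::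
    "nat \<Rightarrow> ((nat set set \<times> nat \<times> nat) \<times> (nat set set \<times> nat \<times> nat)) set" where
  "rooted_iso k =
     {((F, a, b), (G, c, d)). (F, a, b) \<in> rooted_graphs k \<and> (G, c, d) \<in> rooted_graphs k \<and>
        (\<exists>\<phi>. bij_betw \<phi> {1..k} {1..k} \<and>
             (\<forall>u\<in>{1..k}. \<forall>v\<in>{1..k}. {u, v} \<in> F \<longleftrightarrow> {\<phi> u, \<phi> v} \<in> G) \<and>
             \<phi> a = c \<and> \<phi> b = d)}"

definition rooted_classes :: "nat \<Rightarrow> (nat set set \<times> nat \<times> nat) set set" where
  "rooted_classes k = rooted_graphs k // rooted_iso k"

definition root_change ::
    "nat \<Rightarrow> (nat set set \<Rightarrow> nat set set \<Rightarrow> real) \<Rightarrow> nat set set \<times> nat \<times> nat \<Rightarrow> real" where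
  "root_change k R = (\<lambda>(F, a, b).
     (\<Sum>H\<in>labelled_graphs k. R F H * of_bool ({a, b} \<in> H)) - of_bool ({a, b} \<in> F))"

definition class_change ::
    "nat \<Rightarrow> (nat set set \<Rightarrow> nat set set \<Rightarrow> real) \<Rightarrow> (nat set set \<times> nat \<times> nat) set \<Rightarrow> real" where
  "class_change k R J = (\<Sum>X\<in>J. root_change k R X)"

definition atomless :: "'a measure \<Rightarrow> bool" where
  "atomless M \<longleftrightarrow>
     (\<forall>A\<in>sets M. 0 < measure M A \<longrightarrow>
        (\<exists>B\<in>sets M. B \<subseteq> A \<and> 0 < measure M B \<and> measure M B < measure M A))"

text \<open>Separability of the pseudometric space of measurable sets with distance
  \<open>measure M (sym_diff A B)\<close>; every countably generated sigma-algebra has this property.\<close>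

definition separable_sigma_algebra :: "'a measure \<Rightarrow> bool" where
  "separable_sigma_algebra M \<longleftrightarrow>
     (\<exists>\<D>. \<D> \<subseteq> sets M \<and> countable \<D> \<and>
        (\<forall>A\<in>sets M. \<forall>\<epsilon>>0. \<exists>D\<in>\<D>. measure M (sym_diff A D) < \<epsilon>))"

text \<open>Elements of \<open>L\<^sup>\<infinity>\<close> are given by representatives, and equality in \<open>L\<^sup>\<infinity>\<close> is
  equality almost everywhere. The representatives are bounded and symmetric everywhere on the
  space; every almost everywhere symmetric essentially bounded function has such a
  representative.\<close>

definition kernels :: "'a measure \<Rightarrow> ('a \<times> 'a \<Rightarrow> real) set" where
  "kernels M = {W \<in> borel_measurable (M \<Otimes>\<^sub>M M).
     (\<exists>C. \<forall>z\<in>space (M \<Otimes>\<^sub>M M). \<bar>W z\<bar> \<le> C) \<and>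
     (\<forall>x\<in>space M. \<forall>y\<in>space M. W (x, y) = W (y, x))}"

definition graphons :: "'a measure \<Rightarrow> ('a \<times> 'a \<Rightarrow> real) set" where
  "graphons M = {W \<in> kernels M. \<forall>z\<in>space (M \<Otimes>\<^sub>M M). 0 \<le> W z \<and> W z \<le> 1}"

definition Linf_norm :: "'a measure \<Rightarrow> ('a \<times> 'a \<Rightarrow> real) \<Rightarrow> ennreal" where
  "Linf_norm M f = esssup (M \<Otimes>\<^sub>M M) (\<lambda>z. ennreal \<bar>f z\<bar>)"

text \<open>An unordered pair of vertices is represented by the ordered pair \<open>(i, j)\<close> with \<open>i < j\<close>;
  for kernels, which are symmetric, this choice does not matter.\<close>

definition rooted_density ::
    "'a measure \<Rightarrow> nat \<Rightarrow> nat set set \<times> nat \<times> nat \<Rightarrow> ('a \<times> 'a \<Rightarrow> real) \<Rightarrow> 'a \<times> 'a \<Rightarrow> real" where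
  "rooted_density M k = (\<lambda>(F, a, b) W (x, y).
     \<integral>p. (let v = p(a := x, b := y) in
          (\<Prod>(i, j) \<in> {(i, j) \<in> {1..k} \<times> {1..k}. i < j \<and> {i, j} \<in> F}. W (v i, v j)) *
          (\<Prod>(i, j) \<in> {(i, j) \<in> {1..k} \<times> {1..k}. i < j \<and> {i, j} \<notin> F}. 1 - W (v i, v j)))
        \<partial>(PiM ({1..k} - {a, b}) (\<lambda>_. M)))"

definition velocity ::
    "'a measure \<Rightarrow> nat \<Rightarrow> (nat set set \<Rightarrow> nat set set \<Rightarrow> real) \<Rightarrow>
     ('a \<times> 'a \<Rightarrow> real) \<Rightarrow> 'a \<times> 'a \<Rightarrow> real" where
  "velocity M k R W z = (\<Sum>X\<in>rooted_graphs k. root_change k R X * rooted_density M k X W z)"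

text \<open>The differential equation holds in the norm of \<open>L\<^sup>\<infinity>\<close> on \<open>[0, \<infinity>)\<close>, with a one-sided
  derivative at \<open>0\<close>. Values of \<open>u\<close> at negative times play no role.\<close>

definition is_trajectory ::
    "'a measure \<Rightarrow> nat \<Rightarrow> (nat set set \<Rightarrow> nat set set \<Rightarrow> real) \<Rightarrow> ('a \<times> 'a \<Rightarrow> real) \<Rightarrow>
     (real \<Rightarrow> 'a \<times> 'a \<Rightarrow> real) \<Rightarrow> bool" where
  "is_trajectory M k R W u \<longleftrightarrow>
     (\<forall>t\<ge>0. u t \<in> kernels M) \<and>
     (AE z in M \<Otimes>\<^sub>M M. u 0 z = W z) \<and>
     (\<forall>t\<ge>0. ((\<lambda>s. Linf_norm M (\<lambda>z. (u s z - u t z) / (s - t) - velocity M k R (u t) z))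
        \<longlongrightarrow> 0) (at t within {0..}))"

text \<open>The solution is unique in \<open>L\<^sup>\<infinity>\<close>, so its representatives are only determined up to
  null sets; the choice operator picks representatives.\<close>

definition flow ::
    "'a measure \<Rightarrow> nat \<Rightarrow> (nat set set \<Rightarrow> nat set set \<Rightarrow> real) \<Rightarrow> ('a \<times> 'a \<Rightarrow> real) \<Rightarrow>
     real \<Rightarrow> 'a \<times> 'a \<Rightarrow> real" where
  "flow M k R W = (SOME u. is_trajectory M k R W u)"

end

theory Submission
  imports Defs
begin

text \<open>On symmetric kernels the rooted density \<open>T\<^sub>X W\<close> depends only on the isomorphism class of \<open>X\<close>,
  so the velocity depends on the rule only through the class sums; hence equal class sums give the
  same differential equation and the same flow.

  Conversely, differentiating the flows at time 0 shows that the two velocities agree on every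
  graphon. Apply this to the step graphon of a graph \<open>G\<close> on \<open>{1..k}\<close> whose blocks have measures
  proportional to weights \<open>c\<^sub>1, \<dots>, c\<^sub>k\<close>. At a point of the block of the roots \<open>(a\<^sub>0, b\<^sub>0)\<close> the
  difference of the velocities is a homogeneous polynomial of degree \<open>k - 2\<close> in the weights, and
  its coefficient at the product of the \<open>c\<^sub>i\<close> with \<open>i \<noteq> a\<^sub>0, b\<^sub>0\<close> is the difference of the
  class sums of \<open>(G, a\<^sub>0, b\<^sub>0)\<close> times the number of automorphisms of \<open>(G, a\<^sub>0, b\<^sub>0)\<close>. Since
  the measure is atomless, the weights are arbitrary, so this coefficient vanishes.

  Trajectories exist because the velocity is bounded and Lipschitz on graphons: Picard iteration
  solves the equation for the velocity of the truncated kernel, and the solution never leaves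
  \<open>[0, 1]\<close>, because at a point where a graphon is 0 (or 1) its velocity is nonnegative (or
  nonpositive).\<close>

section \<open>Bounded Lipschitz differential equations, pointwise\<close>

text \<open>Two conventions shape the proof. \<open>flow\<close> is a chosen trajectory, so it
  carries information only once a trajectory exists; from equal class sums one gets equal trajectory
  predicates, hence equal choices. Kernels are representatives, bounded and symmetric everywhere,
  while flows are compared up to null sets. The differential equation is therefore solved at each
  point z, with bounds uniform in z: this yields actual functions whose measurability and symmetry
  can be checked, and the uniformity yields the derivative in the L-infinity norm. The velocity is
  polynomial in the kernel and so in general only locally Lipschitz; truncation makes it globally
  Lipschitz, and a single iteration covers all times. For the converse, an identity almost
  everywhere is visible on a pair of blocks only if the pair has positive measure, so all weights
  are kept positive. The block assignments that are bijective onto the non-root blocks become, with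
  the roots added, exactly the isomorphisms to the chosen rooted graph. Hence other classes drop
  out, and all members of the class get the same positive factor.\<close>

lemma LIMSEQ_geometric_increments:
  fixes x :: "nat \<Rightarrow> real"
  assumes "\<And>n. \<bar>x (Suc n) - x n\<bar> \<le> c / 2 ^ n"
  shows "x \<longlonglongrightarrow> lim x" and "\<bar>lim x - x n\<bar> \<le> 2 * c / 2 ^ n"
proof -
  \<comment> \<open>The subtracted term is the remaining geometric tail; keeping it makes the
    induction on m close.\<close>
  have diff: "\<bar>x (m + n) - x n\<bar> \<le> 2 * c / 2 ^ n - 2 * c / 2 ^ (m + n)" for m n
  proof (induction m)
    case (Suc m)
    have "\<bar>x (Suc m + n) - x n\<bar> \<le> \<bar>x (Suc (m + n)) - x (m + n)\<bar> + \<bar>x (m + n) - x n\<bar>"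
      by simp
    also have "\<dots> \<le> c / 2 ^ (m + n) + (2 * c / 2 ^ n - 2 * c / 2 ^ (m + n))"
      using assms Suc by (intro add_mono)
    also have "\<dots> = 2 * c / 2 ^ n - 2 * c / 2 ^ (Suc m + n)"
      by (simp add: field_simps)
    finally show ?case .
  qed simp
  have "0 \<le> c"
    using assms[of 0] by simp
  have bound: "\<bar>x (m + n) - x n\<bar> \<le> 2 * c / 2 ^ n" for m n
    by (rule order_trans[OF diff]) (use \<open>0 \<le> c\<close> in simp)
  have "(\<lambda>n. 2 * c * (1 / 2) ^ n) \<longlonglongrightarrow> 2 * c * 0"
    by (intro tendsto_intros) simp_all
  then have lim0: "(\<lambda>n. 2 * c / 2 ^ n) \<longlonglongrightarrow> 0"
    by (simp add: power_divide)
  have "Cauchy x"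
  proof (rule metric_CauchyI)
    fix e :: real assume "0 < e"
    then obtain N where N: "2 * c / 2 ^ N < e / 2"
      using order_tendstoD(2)[OF lim0, of "e / 2"] eventually_sequentially by auto
    have "dist (x m) (x n) < e" if "m \<ge> N" "n \<ge> N" for m n
      using bound[of "m - N" N] bound[of "n - N" N] that N by (simp add: dist_real_def)
    then show "\<exists>N. \<forall>m\<ge>N. \<forall>n\<ge>N. dist (x m) (x n) < e"
      by blast
  qed
  then show lim: "x \<longlonglongrightarrow> lim x"
    using Cauchy_convergent convergent_LIMSEQ_iff by blast
  have "(\<lambda>m. \<bar>x (m + n) - x n\<bar>) \<longlonglongrightarrow> \<bar>lim x - x n\<bar>"
    by (intro tendsto_intros LIMSEQ_ignore_initial_segment lim)
  then show "\<bar>lim x - x n\<bar> \<le> 2 * c / 2 ^ n"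
    by (rule LIMSEQ_le_const2) (use bound in blast)
qed

text \<open>The indicator turns the integral from 0 to t into one over all of \<open>lborel\<close>,
  so that measurability in t and z together follows from the product sigma-algebra. At negative
  times every iterate is w.\<close>

primrec picard_iterate ::
    "(('z \<Rightarrow> real) \<Rightarrow> 'z \<Rightarrow> real) \<Rightarrow> ('z \<Rightarrow> real) \<Rightarrow> nat \<Rightarrow> real \<Rightarrow> 'z \<Rightarrow> real" where
  "picard_iterate V w 0 t z = w z"
| "picard_iterate V w (Suc n) t z =
     w z + (LINT s|lborel. indicator {0..t} s * V (picard_iterate V w n s) z)"

lemma picard_iterate_0: "picard_iterate V w 0 = (\<lambda>t. w)"
  by (intro ext) simp

lemma integrable_indicator_Icc: "integrable lborel (indicator {a..b} :: real \<Rightarrow> real)"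
  by (intro integrable_real_indicator) (auto simp: emeasure_lborel_Icc_eq)

text \<open>V may use all of the function U, so measurability is demanded jointly in time and point:
  the iteration integrates in time at a fixed z but needs the whole function at each time. The
  Lipschitz condition bounds V at a point by a uniform distance d between U and U'.\<close>

locale bounded_lipschitz_field =
  fixes \<Omega> :: "'z measure" and V :: "('z \<Rightarrow> real) \<Rightarrow> 'z \<Rightarrow> real" and C L :: real
  assumes measurable_field:
      "\<And>U. (\<lambda>(s, z). U s z) \<in> borel_measurable ((lborel :: real measure) \<Otimes>\<^sub>M \<Omega>) \<Longrightarrow>
         (\<lambda>(s, z). V (U s) z) \<in> borel_measurable (lborel \<Otimes>\<^sub>M \<Omega>)"
    and bounded_field: "\<And>U z. U \<in> borel_measurable \<Omega> \<Longrightarrow> z \<in> space \<Omega> \<Longrightarrow> \<bar>V U z\<bar> \<le> C"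
    and lipschitz_field: "\<And>U U' d z. U \<in> borel_measurable \<Omega> \<Longrightarrow> U' \<in> borel_measurable \<Omega> \<Longrightarrow>
         (\<And>y. y \<in> space \<Omega> \<Longrightarrow> \<bar>U y - U' y\<bar> \<le> d) \<Longrightarrow> z \<in> space \<Omega> \<Longrightarrow> \<bar>V U z - V U' z\<bar> \<le> L * d"
    and C_nonneg: "0 \<le> C" and L_pos: "0 < L"
begin

lemma integrable_along:
  assumes [measurable]: "(\<lambda>(s, z). U s z) \<in> borel_measurable (lborel \<Otimes>\<^sub>M \<Omega>)" and z: "z \<in> space \<Omega>"
  shows "integrable lborel (\<lambda>s. indicator {a..b::real} s * V (U s) z)"
proof (rule Bochner_Integration.integrable_bound)
  have "U s = (\<lambda>y. (case (s, y) of (s, z) \<Rightarrow> U s z))" for s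
    by simp
  moreover have "(\<lambda>y. (case (s, y) of (s, z) \<Rightarrow> U s z)) \<in> borel_measurable \<Omega>" for s
    by measurable
  ultimately have U: "U s \<in> borel_measurable \<Omega>" for s
    by metis
  show "integrable lborel (\<lambda>s. C * indicator {a..b} s)"
    by (intro integrable_mult_right integrable_indicator_Icc)
  have "(\<lambda>s. (case (s, z) of (s, z) \<Rightarrow> V (U s) z)) \<in> borel_measurable lborel"
    by (rule measurable_compose[OF _ measurable_field]) (use z in simp_all)
  then show "(\<lambda>s. indicator {a..b} s * V (U s) z) \<in> borel_measurable lborel"
    by simp
  show "AE s in lborel. norm (indicator {a..b} s * V (U s) z) \<le> norm (C * indicator {a..b} s)"
    using bounded_field[OF U z] C_nonneg by (auto simp: indicator_def)
qed

lemma section_measurable: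
  assumes [measurable]: "(\<lambda>(s, z). U s z) \<in> borel_measurable ((lborel :: real measure) \<Otimes>\<^sub>M \<Omega>)"
  shows "U s \<in> borel_measurable \<Omega>"
proof -
  have "(\<lambda>y. (case (s, y) of (s, z) \<Rightarrow> U s z)) \<in> borel_measurable \<Omega>"
    by measurable
  then show ?thesis
    by simp
qed

lemma picard_iterate_measurable:
  assumes w[measurable]: "w \<in> borel_measurable \<Omega>"
  shows "(\<lambda>(s, z). picard_iterate V w n s z) \<in> borel_measurable (lborel \<Otimes>\<^sub>M \<Omega>)"
proof (induction n)
  case 0
  then show ?case by simp
next
  case (Suc n)
  have [measurable]: "(\<lambda>(s, z). V (picard_iterate V w n s) z) \<in> borel_measurable (lborel \<Otimes>\<^sub>M \<Omega>)"
    by (rule measurable_field[OF Suc])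
  have "(\<lambda>x. (LINT s|lborel. indicator {0..fst x} s * V (picard_iterate V w n s) (snd x)))
      \<in> borel_measurable (lborel \<Otimes>\<^sub>M \<Omega>)"
  proof (rule lborel.borel_measurable_lebesgue_integral)
    have "(\<lambda>(x, s). (if 0 \<le> s \<and> s \<le> fst x then 1 else 0) *
        (case (s, snd x) of (s, z) \<Rightarrow> V (picard_iterate V w n s) z))
      \<in> borel_measurable ((lborel \<Otimes>\<^sub>M \<Omega>) \<Otimes>\<^sub>M lborel)"
      by measurable
    then show "(\<lambda>(x, s). indicator {0..fst x} s * V (picard_iterate V w n s) (snd x))
      \<in> borel_measurable ((lborel \<Otimes>\<^sub>M \<Omega>) \<Otimes>\<^sub>M lborel)"
      by (simp add: indicator_def of_bool_def)
  qed
  then show ?case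
    by (simp add: case_prod_beta)
qed

text \<open>In the norm weighted by exp (2 * L * t) the integral operator contracts by 1/2, because
  L times the integral of exp (2 * L * s) over [0, t] is at most exp (2 * L * t) / 2. The constant C
  / (2 * L) comes from the first increment, which is at most C * t, and from x \<le> exp x at x = 2
  * L * t.\<close>

lemma picard_iterate_increment:
  assumes w: "w \<in> borel_measurable \<Omega>" and "0 \<le> t" and z: "z \<in> space \<Omega>"
  shows "\<bar>picard_iterate V w (Suc n) t z - picard_iterate V w n t z\<bar> \<le> C / (2 * L) * exp (2 * L * t) / 2 ^ n"
  using \<open>0 \<le> t\<close> z
proof (induction n arbitrary: t z)
  case 0
  have "\<bar>LINT s|lborel. indicator {0..t} s * V w z\<bar> \<le> C * t"
    using bounded_field[OF w 0(2)] 0 by (simp add: abs_mult mult.commute[of C] mult_left_mono)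
  also have "\<dots> = C / (2 * L) * (2 * L * t)"
    using L_pos by simp
  also have "\<dots> \<le> C / (2 * L) * exp (2 * L * t)"
    using exp_ge_add_one_self[of "2 * L * t"] C_nonneg L_pos
    by (intro mult_left_mono) (linarith | simp)+
  finally show ?case
    unfolding picard_iterate.simps(2) picard_iterate_0 by (simp only: add_diff_cancel_left' power_0 div_by_1)
next
  case (Suc n)
  let ?u = "picard_iterate V w" and ?B = "C / (2 * L)"
  have int: "integrable lborel (\<lambda>s. indicator {0..t} s * V (?u n s) z)" for n
    by (rule integrable_along[OF picard_iterate_measurable[OF w] Suc.prems(2)])
  have exp_int: "has_bochner_integral lborel
      (\<lambda>s. (?B / 2 ^ n * L * exp (2 * L * s)) * indicator {0..t} s)
      (?B / 2 ^ Suc n * exp (2 * L * t) - ?B / 2 ^ Suc n * exp (2 * L * 0))"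
    using L_pos by (intro has_bochner_integral_FTC_Icc_real Suc.prems(1))
      (auto intro!: derivative_eq_intros continuous_intros simp: field_simps)
  have "\<bar>?u (Suc (Suc n)) t z - ?u (Suc n) t z\<bar> =
      \<bar>LINT s|lborel. indicator {0..t} s * V (?u (Suc n) s) z - indicator {0..t} s * V (?u n s) z\<bar>"
    by (subst Bochner_Integration.integral_diff[OF int int]) simp
  also have "\<dots> \<le> (LINT s|lborel. (?B / 2 ^ n * L * exp (2 * L * s)) * indicator {0..t} s)"
  proof (subst real_norm_def[symmetric], rule Bochner_Integration.integral_norm_bound_integral)
    fix s :: real
    have "\<bar>V (?u (Suc n) s) z - V (?u n s) z\<bar> \<le> L * (?B * exp (2 * L * s) / 2 ^ n)" if "0 \<le> s"
      using Suc.IH[OF that] Suc.prems(2)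
      by (intro lipschitz_field section_measurable[OF picard_iterate_measurable[OF w]]) auto
    then show "norm (indicator {0..t} s * V (?u (Suc n) s) z - indicator {0..t} s * V (?u n s) z)
        \<le> (?B / 2 ^ n * L * exp (2 * L * s)) * indicator {0..t} s"
      using L_pos by (auto simp: indicator_def ac_simps)
  qed (intro Bochner_Integration.integrable_diff int
      exp_int[unfolded has_bochner_integral_iff, THEN conjunct1])+
  also have "\<dots> = ?B / 2 ^ Suc n * exp (2 * L * t) - ?B / 2 ^ Suc n"
    using has_bochner_integral_integral_eq[OF exp_int] by simp
  also have "\<dots> \<le> ?B * exp (2 * L * t) / 2 ^ Suc n"
    using C_nonneg L_pos by simp
  finally show ?case .
qed

lemma solution_exists:
  assumes w: "w \<in> borel_measurable \<Omega>"
  obtains u where "\<And>t. 0 \<le> t \<Longrightarrow> u t \<in> borel_measurable \<Omega>"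
    and "\<And>z. z \<in> space \<Omega> \<Longrightarrow> u 0 z = w z"
    and "\<And>t z. 0 \<le> t \<Longrightarrow> z \<in> space \<Omega> \<Longrightarrow>
           ((\<lambda>s. u s z) has_real_derivative V (u t) z) (at t within {0..})"
    and "\<And>s t z. 0 \<le> s \<Longrightarrow> 0 \<le> t \<Longrightarrow> z \<in> space \<Omega> \<Longrightarrow> \<bar>u s z - u t z\<bar> \<le> C * \<bar>s - t\<bar>"
proof -
  let ?u = "picard_iterate V w"
  \<comment> \<open>The increment bound is available only at nonnegative times; clamping makes
    \<open>u\<close> a limit at every real time, as joint measurability over \<open>lborel\<close>
    requires.\<close>
  define u where "u t z = lim (\<lambda>n. ?u n (max t 0) z)" for t z
  note incr = picard_iterate_increment[OF w]
  have meas_n: "?u n t \<in> borel_measurable \<Omega>" for n t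
    by (rule section_measurable[OF picard_iterate_measurable[OF w]])
  have lim: "(\<lambda>n. ?u n t z) \<longlonglongrightarrow> u t z" and
    err: "\<bar>u t z - ?u n t z\<bar> \<le> C / L * exp (2 * L * t) / 2 ^ n" if "0 \<le> t" "z \<in> space \<Omega>" for t z n
  proof -
    have "max t 0 = t"
      using that by simp
    then show "(\<lambda>n. ?u n t z) \<longlonglongrightarrow> u t z" "\<bar>u t z - ?u n t z\<bar> \<le> C / L * exp (2 * L * t) / 2 ^ n"
      using LIMSEQ_geometric_increments[of "\<lambda>n. ?u n t z", OF incr[OF that]] by (simp_all add: u_def)
  qed
  have joint: "(\<lambda>(s, z). u s z) \<in> borel_measurable (lborel \<Otimes>\<^sub>M \<Omega>)"
  proof (rule borel_measurable_LIMSEQ_real)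
    fix n
    have [measurable]: "(\<lambda>(s, z). ?u n s z) \<in> borel_measurable (lborel \<Otimes>\<^sub>M \<Omega>)"
      by (rule picard_iterate_measurable[OF w])
    have "(\<lambda>x. case (max (fst x) 0, snd x) of (s, z) \<Rightarrow> ?u n s z) \<in> borel_measurable (lborel \<Otimes>\<^sub>M \<Omega>)"
      by measurable
    then show "(\<lambda>x. ?u n (max (fst x) 0) (snd x)) \<in> borel_measurable (lborel \<Otimes>\<^sub>M \<Omega>)"
      by simp
  next
    fix x :: "real \<times> 'z" assume "x \<in> space (lborel \<Otimes>\<^sub>M \<Omega>)"
    then have "snd x \<in> space \<Omega>"
      by (auto simp: space_pair_measure)
    then have "(\<lambda>n. ?u n (max (fst x) 0) (snd x)) \<longlonglongrightarrow> u (max (fst x) 0) (snd x)"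
      by (intro lim) auto
    then show "(\<lambda>n. ?u n (max (fst x) 0) (snd x)) \<longlonglongrightarrow> (case x of (s, z) \<Rightarrow> u s z)"
      by (simp add: u_def case_prod_beta)
  qed
  have meas: "u t \<in> borel_measurable \<Omega>" for t
    by (rule section_measurable[OF joint])
  have V_lim: "(\<lambda>n. V (?u n s) z) \<longlonglongrightarrow> V (u s) z" if "0 \<le> s" "z \<in> space \<Omega>" for s z
  proof (rule LIM_zero_cancel, rule Lim_null_comparison)
    define K where "K = C * exp (2 * L * s)"
    have "norm (V (?u n s) z - V (u s) z) \<le> K * (1 / 2) ^ n" for n
    proof -
      have "\<bar>V (?u n s) z - V (u s) z\<bar> \<le> L * (C / L * exp (2 * L * s) / 2 ^ n)"
        using err[OF that(1)] that(2)
        by (intro lipschitz_field meas_n meas) (simp_all add: abs_minus_commute)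
      also have "\<dots> = K * (1 / 2) ^ n"
        using L_pos by (simp add: K_def power_divide)
      finally show ?thesis
        by simp
    qed
    then show "\<forall>\<^sub>F n in sequentially. norm (V (?u n s) z - V (u s) z) \<le> K * (1 / 2) ^ n"
      by simp
    have "(\<lambda>n. K * (1 / 2) ^ n) \<longlonglongrightarrow> K * 0"
      by (intro tendsto_intros) simp_all
    then show "(\<lambda>n. K * (1 / 2) ^ n) \<longlonglongrightarrow> 0"
      by simp
  qed
  have equation: "u t z = w z + (LINT s|lborel. indicator {0..t} s * V (u s) z)"
    if "0 \<le> t" and z: "z \<in> space \<Omega>" for t z
  proof -
    have "(\<lambda>n. LINT s|lborel. indicator {0..t} s * V (?u n s) z)
        \<longlonglongrightarrow> (LINT s|lborel. indicator {0..t} s * V (u s) z)"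
    proof (rule integral_dominated_convergence[where w="\<lambda>s. C * indicator {0..t} s"])
      show "AE s in lborel. (\<lambda>n. indicator {0..t} s * V (?u n s) z) \<longlonglongrightarrow> indicator {0..t} s * V (u s) z"
        using V_lim[OF _ z] by (auto simp: indicator_def)
      show "AE s in lborel. norm (indicator {0..t} s * V (?u n s) z) \<le> C * indicator {0..t} s" for n
        using bounded_field[OF meas_n z] by (auto simp: indicator_def)
    qed (use integrable_along[OF joint z] integrable_along[OF picard_iterate_measurable[OF w] z]
        integrable_mult_right[OF integrable_indicator_Icc] in \<open>auto simp del: integrable_mult_right_iff\<close>)
    then have "(\<lambda>n. ?u (Suc n) t z) \<longlonglongrightarrow> w z + (LINT s|lborel. indicator {0..t} s * V (u s) z)"
      by (simp add: tendsto_add)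
    moreover have "(\<lambda>n. ?u (Suc n) t z) \<longlonglongrightarrow> u t z"
      by (rule LIMSEQ_Suc[OF lim[OF that]])
    ultimately show ?thesis
      using LIMSEQ_unique by blast
  qed
  have lip_le: "\<bar>u s z - u t z\<bar> \<le> C * \<bar>s - t\<bar>" if "0 \<le> s" "s \<le> t" and z: "z \<in> space \<Omega>" for s t z
  proof -
    note int = integrable_along[OF joint z]
    have "u t z - u s z = (LINT r|lborel. indicator {0..t} r * V (u r) z - indicator {0..s} r * V (u r) z)"
      using that by (subst Bochner_Integration.integral_diff[OF int int]) (simp add: equation)
    also have "\<bar>\<dots>\<bar> \<le> (LINT r|lborel. C * indicator {s..t} r)"
    proof (subst real_norm_def[symmetric], rule Bochner_Integration.integral_norm_bound_integral)
      fix r :: real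
      show "norm (indicator {0..t} r * V (u r) z - indicator {0..s} r * V (u r) z) \<le> C * indicator {s..t} r"
        using bounded_field[OF meas z, of r] that C_nonneg by (auto simp: indicator_def)
    qed (intro Bochner_Integration.integrable_diff int integrable_mult_right integrable_indicator_Icc)+
    finally show ?thesis
      using that by (simp add: abs_minus_commute)
  qed
  have lip: "\<bar>u s z - u t z\<bar> \<le> C * \<bar>s - t\<bar>" if "0 \<le> s" "0 \<le> t" and z: "z \<in> space \<Omega>" for s t z
    using lip_le[of s t z] lip_le[of t s z] that by (cases "s \<le> t") (auto simp: abs_minus_commute)
  have deriv: "((\<lambda>s. u s z) has_real_derivative V (u t) z) (at t within {0..})"
    if "0 \<le> t" and z: "z \<in> space \<Omega>" for t z
  proof -
    have cont: "continuous_on {0..t+1} (\<lambda>s. V (u s) z)"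
    proof (rule continuous_on_subset[OF lipschitz_on_continuous_on])
      show "(L * C)-lipschitz_on {0..} (\<lambda>s. V (u s) z)"
      proof (rule lipschitz_onI)
        fix s r :: real assume "s \<in> {0..}" "r \<in> {0..}"
        then have "\<bar>V (u s) z - V (u r) z\<bar> \<le> L * (C * \<bar>s - r\<bar>)"
          using z by (intro lipschitz_field meas lip) auto
        then show "dist (V (u s) z) (V (u r) z) \<le> L * C * dist s r"
          by (simp add: dist_real_def)
      qed (use L_pos C_nonneg in simp)
    qed auto
    \<comment> \<open>The fundamental theorem is applied on the compact interval [0, t + 1]. Near t
      this interval agrees with [0, infinity), also for t = 0, where the derivative is
      one-sided.\<close>
    have "((\<lambda>s. w z + integral {0..s} (\<lambda>r. V (u r) z)) has_real_derivative 0 + V (u t) z)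
        (at t within {0..t+1})"
      using \<open>0 \<le> t\<close> by (intro DERIV_add DERIV_const integral_has_real_derivative[OF cont]) auto
    then have "((\<lambda>s. w z + integral {0..s} (\<lambda>r. V (u r) z)) has_real_derivative V (u t) z)
        (at t within {0..})"
      using \<open>0 \<le> t\<close> by (subst at_within_nhd[of t "{..<t+1}" "{0..}" "{0..t+1}"]) auto
    moreover have "u s z = w z + integral {0..s} (\<lambda>r. V (u r) z)" if "0 \<le> s" for s
    proof -
      have "set_integrable lborel {0..s} (\<lambda>r. V (u r) z)"
        using integrable_along[OF joint z] by (simp add: set_integrable_def)
      then show ?thesis
        using set_borel_integral_eq_integral(2)[of "{0..s}" "\<lambda>r. V (u r) z"] equation[OF that z]
        by (simp add: set_lebesgue_integral_def)
    qed
    ultimately show ?thesis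
      using \<open>0 \<le> t\<close> by (auto intro: has_field_derivative_transform_within[OF _ zero_less_one])
  qed
  have "u 0 z = w z" if "z \<in> space \<Omega>" for z
  proof -
    have "AE s in lborel. indicator {0..0::real} s * V (u s) z = 0"
      using AE_lborel_singleton[of "0::real"] by eventually_elim simp
    then show ?thesis
      using equation[of 0 z] that by (simp add: integral_eq_zero_AE)
  qed
  then show thesis
    by (rule that[OF meas _ deriv lip])
qed

end

section \<open>Atomless measures\<close>

text \<open>If D is a subset of B of smaller positive measure, then D and B - D both have positive
  measure and one of them has at most half the measure of B. Iterating brings the measure below any
  bound.\<close>

lemma (in finite_measure) atomless_small_subset:
  assumes "atomless M" and "A \<in> sets M" "0 < measure M A" and "0 < e"
  obtains B where "B \<in> sets M" "B \<subseteq> A" "0 < measure M B" "measure M B < e"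
proof -
  have half: "\<exists>B\<in>sets M. B \<subseteq> A \<and> 0 < measure M B \<and> measure M B \<le> measure M A / 2 ^ n" for n
  proof (induction n)
    case 0
    then show ?case
      using assms by auto
  next
    case (Suc n)
    then obtain B where B: "B \<in> sets M" "B \<subseteq> A" "0 < measure M B" "measure M B \<le> measure M A / 2 ^ n"
      by blast
    then obtain D where D: "D \<in> sets M" "D \<subseteq> B" "0 < measure M D" "measure M D < measure M B"
      using assms(1) by (auto simp: atomless_def)
    have "measure M (B - D) = measure M B - measure M D"
      using B D by (intro finite_measure_Diff) auto
    then consider "measure M D \<le> measure M B / 2" | "measure M (B - D) \<le> measure M B / 2"
      by linarith
    then show ?case
    proof cases
      case 1
      then have "measure M D \<le> measure M A / 2 ^ Suc n"
        using B by simp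
      then show ?thesis
        using B D by blast
    next
      case 2
      then have "measure M (B - D) \<le> measure M A / 2 ^ Suc n"
        using B by simp
      moreover have "0 < measure M (B - D)"
        using \<open>measure M (B - D) = _\<close> D by simp
      ultimately show ?thesis
        using B D by blast
    qed
  qed
  have "(\<lambda>n. measure M A * (1 / 2) ^ n) \<longlonglongrightarrow> measure M A * 0"
    by (intro tendsto_intros) simp_all
  then have "(\<lambda>n. measure M A / 2 ^ n) \<longlonglongrightarrow> 0"
    by (simp add: power_divide)
  then obtain n where "measure M A / 2 ^ n < e"
    using order_tendstoD(2)[OF _ \<open>0 < e\<close>] eventually_sequentially by (metis order_refl)
  then show thesis
    using half[of n] that by force
qed

text \<open>Sierpinski's theorem. A set of measure \<open>r\<close> is exhausted greedily: each step adds a set whose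
  measure is at least half of what is still possible.\<close>

lemma (in finite_measure) atomless_subset_of_measure:
  assumes atomless: "atomless M" and A: "A \<in> sets M" and r: "0 \<le> r" "r \<le> measure M A"
  obtains B where "B \<in> sets M" "B \<subseteq> A" "measure M B = r"
proof -
  define adm where "adm B = {D \<in> sets M. D \<subseteq> A - B \<and> measure M B + measure M D \<le> r}" for B
  have step: "\<exists>D\<in>adm B. \<forall>D'\<in>adm B. measure M D' \<le> 2 * measure M D" if "measure M B \<le> r" for B
  proof (cases "\<exists>D\<in>adm B. 0 < measure M D")
    case True
    then obtain D0 where D0: "D0 \<in> adm B" "0 < measure M D0"
      by blast
    have bdd: "bdd_above (measure M ` adm B)"
      by (rule bdd_aboveI[of _ "r - measure M B"]) (auto simp: adm_def)
    let ?s = "Sup (measure M ` adm B)"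
    have le: "measure M D \<le> ?s" if "D \<in> adm B" for D
      using that by (intro cSup_upper bdd) auto
    have "?s / 2 < ?s"
      using le[OF D0(1)] D0(2) by linarith
    then obtain D where "D \<in> adm B" "?s / 2 < measure M D"
      using less_cSup_iff[of "measure M ` adm B", OF _ bdd] D0 by blast
    then show ?thesis
      using le by force
  next
    case False
    have "{} \<in> adm B"
      using that by (auto simp: adm_def)
    then show ?thesis
      using False by (intro bexI[of _ "{}"]) (auto simp: not_less)
  qed
  then obtain next_piece where next_piece:
    "\<And>B. measure M B \<le> r \<Longrightarrow> next_piece B \<in> adm B"
    "\<And>B D'. measure M B \<le> r \<Longrightarrow> D' \<in> adm B \<Longrightarrow> measure M D' \<le> 2 * measure M (next_piece B)"
    by metis
  define F where "F = rec_nat {} (\<lambda>_ B. B \<union> next_piece B)"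
  have F_Suc: "F (Suc n) = F n \<union> next_piece (F n)" for n
    by (simp add: F_def)
  have F: "F n \<in> sets M \<and> F n \<subseteq> A \<and> measure M (F n) \<le> r" for n
  proof (induction n)
    case 0
    then show ?case
      using r by (simp add: F_def)
  next
    case (Suc n)
    then have "next_piece (F n) \<in> adm (F n)"
      using next_piece(1) by blast
    moreover from this have "F n \<inter> next_piece (F n) = {}"
      by (auto simp: adm_def)
    ultimately show ?case
      using Suc finite_measure_Union[of "F n" "next_piece (F n)"] by (auto simp: F_Suc adm_def)
  qed
  have measure_Suc: "measure M (F (Suc n)) = measure M (F n) + measure M (next_piece (F n))" for n
  proof -
    have "next_piece (F n) \<in> adm (F n)"
      using F next_piece(1) by blast
    moreover from this have "F n \<inter> next_piece (F n) = {}"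
      by (auto simp: adm_def)
    ultimately show ?thesis
      using F[of n] finite_measure_Union[of "F n" "next_piece (F n)"] by (auto simp: F_Suc adm_def)
  qed
  have "incseq F"
    by (rule incseq_SucI) (simp add: F_Suc)
  then have lim: "(\<lambda>n. measure M (F n)) \<longlonglongrightarrow> measure M (\<Union>n. F n)"
    using F by (intro finite_Lim_measure_incseq) auto
  have sets: "(\<Union>n. F n) \<in> sets M" and sub: "(\<Union>n. F n) \<subseteq> A"
    using F by auto
  have le: "measure M (\<Union>n. F n) \<le> r"
    using F by (intro LIMSEQ_le_const2[OF lim]) auto
  \<comment> \<open>If the union fell short of r, a small set E of positive measure in the remainder
    would be admissible at every step. Each piece would then have at least half the measure of E,
    while the measures of the pieces tend to 0.\<close>
  have "\<not> measure M (\<Union>n. F n) < r"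
  proof
    assume less: "measure M (\<Union>n. F n) < r"
    have "measure M (A - (\<Union>n. F n)) = measure M A - measure M (\<Union>n. F n)"
      using A sets sub by (intro finite_measure_Diff) auto
    then have "0 < measure M (A - (\<Union>n. F n))"
      using less r by simp
    moreover have "A - (\<Union>n. F n) \<in> sets M"
      using A sets by blast
    ultimately obtain E where E: "E \<in> sets M" "E \<subseteq> A - (\<Union>n. F n)" "0 < measure M E"
      "measure M E < r - measure M (\<Union>n. F n)"
      using less atomless_small_subset[OF atomless, of "A - (\<Union>n. F n)" "r - measure M (\<Union>n. F n)"]
      by (metis diff_gt_0_iff_gt)
    have piece: "measure M E \<le> 2 * measure M (next_piece (F n))" for n
    proof (rule next_piece(2))
      have "measure M (F n) \<le> measure M (\<Union>n. F n)"
        using sets by (intro finite_measure_mono) auto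
      then show "E \<in> adm (F n)"
        using E by (auto simp: adm_def)
    qed (use F in blast)
    have "(\<lambda>n. measure M (F (Suc n)) - measure M (F n)) \<longlonglongrightarrow> measure M (\<Union>n. F n) - measure M (\<Union>n. F n)"
      by (intro tendsto_diff LIMSEQ_Suc lim)
    then have "(\<lambda>n. measure M (next_piece (F n))) \<longlonglongrightarrow> 0"
      by (simp add: measure_Suc)
    moreover have "measure M E / 2 \<le> measure M (next_piece (F n))" for n
      using piece[of n] by simp
    ultimately have "measure M E / 2 \<le> 0"
      by (intro LIMSEQ_le_const) auto
    then show False
      using E by simp
  qed
  then show thesis
    using that[OF sets sub] le by simp
qed

text \<open>A block of measure c j is split off and the rest of A is divided by induction. The
  partition is given by its labelling map, the form in which \<open>step_graphon\<close> takes
  it.\<close>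

lemma (in finite_measure) atomless_block_map:
  fixes c :: "'b \<Rightarrow> real"
  assumes "atomless M" and "finite I" and "I \<noteq> {}" and "\<And>i. i \<in> I \<Longrightarrow> 0 \<le> c i"
    and "A \<in> sets M" and "sum c I = measure M A"
  shows "\<exists>f. f \<in> A \<rightarrow> I \<and> (\<forall>i\<in>I. {x \<in> A. f x = i} \<in> sets M \<and> measure M {x \<in> A. f x = i} = c i)"
  using assms(2-)
proof (induction I arbitrary: A rule: finite_ne_induct)
  case (singleton i)
  then show ?case
    by (intro exI[of _ "\<lambda>_. i"]) simp
next
  case (insert j I)
  have "c j \<le> measure M A"
    using insert by (simp add: sum_nonneg flip: insert.prems(3))
  then obtain B where B: "B \<in> sets M" "B \<subseteq> A" "measure M B = c j"
    using atomless_subset_of_measure[OF assms(1) insert.prems(2)] insert.prems(1) by blast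
  have "measure M (A - B) = measure M A - measure M B"
    using B insert.prems by (intro finite_measure_Diff) auto
  then have "sum c I = measure M (A - B)"
    using insert.prems(3) insert.hyps B by simp
  then have "\<exists>f. f \<in> A - B \<rightarrow> I \<and>
      (\<forall>i\<in>I. {x \<in> A - B. f x = i} \<in> sets M \<and> measure M {x \<in> A - B. f x = i} = c i)"
    using insert.prems B by (intro insert.IH) auto
  then obtain f where f: "f \<in> A - B \<rightarrow> I"
    "\<And>i. i \<in> I \<Longrightarrow> {x \<in> A - B. f x = i} \<in> sets M \<and> measure M {x \<in> A - B. f x = i} = c i"
    by blast
  let ?g = "\<lambda>x. if x \<in> B then j else f x"
  have "{x \<in> A. ?g x = j} = B"
    using B f insert.hyps by auto
  moreover have "{x \<in> A. ?g x = i} = {x \<in> A - B. f x = i}" if "i \<in> I" for i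
    using that insert.hyps by auto
  moreover have "?g \<in> A \<rightarrow> insert j I"
    using f(1) by (auto simp: Pi_iff)
  ultimately show ?case
    using B f(2) by (intro exI[of _ ?g]) auto
qed

section \<open>Rooted densities\<close>

text \<open>Otherwise the simplifier turns \<open>{1..k}\<close> into \<open>{Suc 0..k}\<close>.\<close>

declare One_nat_def [simp del]

definition vertex_pairs :: "nat \<Rightarrow> (nat \<times> nat) set" where
  "vertex_pairs k = {(i, j) \<in> {1..k} \<times> {1..k}. i < j}"

text \<open>The integrand of \<open>rooted_density\<close>, with the products over edges and
  non-edges merged. For a graphon W it is the probability that the W-random graph on the sample
  points v has edge set F.\<close>

definition edge_product :: "nat \<Rightarrow> nat set set \<Rightarrow> ('a \<times> 'a \<Rightarrow> real) \<Rightarrow> (nat \<Rightarrow> 'a) \<Rightarrow> real" where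
  "edge_product k F W v = (\<Prod>e\<in>vertex_pairs k.
     if {fst e, snd e} \<in> F then W (v (fst e), v (snd e)) else 1 - W (v (fst e), v (snd e)))"

lemma finite_vertex_pairs [simp]: "finite (vertex_pairs k)"
  by (rule finite_subset[of _ "{1..k} \<times> {1..k}"]) (auto simp: vertex_pairs_def)

lemma finite_labelled_graphs [simp]: "finite (labelled_graphs k)"
  by (simp add: labelled_graphs_def finite_imp_finite_nsets)

lemma finite_rooted_graphs [simp]: "finite (rooted_graphs k)"
proof -
  have "finite {(a, b) \<in> {1..k} \<times> {1..k}. a \<noteq> b}"
    by (rule finite_subset[of _ "{1..k} \<times> {1..k}"]) auto
  then show ?thesis
    unfolding rooted_graphs_def by (intro finite_cartesian_product finite_labelled_graphs)
qed

lemma rooted_graphsD: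
  "(F, a, b) \<in> rooted_graphs k \<Longrightarrow> F \<in> labelled_graphs k \<and> a \<in> {1..k} \<and> b \<in> {1..k} \<and> a \<noteq> b"
  by (auto simp: rooted_graphs_def)

lemma rooted_density_eq:
  "rooted_density M k (F, a, b) W (x, y) =
     (\<integral>p. edge_product k F W (p(a := x, b := y)) \<partial>(PiM ({1..k} - {a, b}) (\<lambda>_. M)))"
proof -
  have "(\<Prod>(i, j) \<in> {(i, j) \<in> {1..k} \<times> {1..k}. i < j \<and> {i, j} \<in> F}. W (v i, v j)) *
      (\<Prod>(i, j) \<in> {(i, j) \<in> {1..k} \<times> {1..k}. i < j \<and> {i, j} \<notin> F}. 1 - W (v i, v j)) =
      edge_product k F W v" for v
    unfolding edge_product_def
    by (subst prod.If_cases, simp)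
      (auto simp: vertex_pairs_def case_prod_beta intro!: arg_cong2[where f=times] prod.cong)
  then show ?thesis
    by (simp only: rooted_density_def Let_def prod.case)
qed

lemma edge_product_cong:
  assumes "\<And>i. i \<in> {1..k} \<Longrightarrow> v i = v' i"
    and "\<And>i j. (i, j) \<in> vertex_pairs k \<Longrightarrow> W (v' i, v' j) = W' (v' i, v' j)"
  shows "edge_product k F W v = edge_product k F W' v'"
  unfolding edge_product_def
  using assms by (intro prod.cong) (auto simp: vertex_pairs_def)

lemma bij_betw_vertex_pairs: "bij_betw (\<lambda>e. {fst e, snd e}) (vertex_pairs k) (nsets {1..k} 2)"
  unfolding bij_betw_def
proof
  show "inj_on (\<lambda>e. {fst e, snd e}) (vertex_pairs k)"
    by (auto simp: inj_on_def doubleton_eq_iff vertex_pairs_def)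
  have "{i, j} \<in> (\<lambda>e. {fst e, snd e}) ` vertex_pairs k" if "i \<in> {1..k}" "j \<in> {1..k}" "i < j" for i j
    using that by (intro image_eqI[of _ _ "(i, j)"]) (auto simp: vertex_pairs_def)
  then show "(\<lambda>e. {fst e, snd e}) ` vertex_pairs k = nsets {1..k} 2"
    unfolding ordered_nsets_2_eq by (fastforce simp: vertex_pairs_def)
qed

text \<open>Indexing by two-element sets lets a vertex bijection act on the index set by images;
  \<open>Min\<close> and \<open>Max\<close> recover the ordered pair.\<close>

lemma edge_product_nsets:
  "edge_product k F W v = (\<Prod>e\<in>nsets {1..k} 2.
     if e \<in> F then W (v (Min e), v (Max e)) else 1 - W (v (Min e), v (Max e)))"
  unfolding edge_product_def
  by (subst prod.reindex_bij_betw[OF bij_betw_vertex_pairs, symmetric])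
    (rule prod.cong, auto simp: vertex_pairs_def min_def max_def)

text \<open>A bijection permutes the unordered pairs but may reverse the order of the endpoints of a
  pair; the symmetry of W at the points of v absorbs this.\<close>

lemma edge_product_iso:
  assumes bij: "bij_betw \<phi> {1..k} {1..k}"
    and iso: "\<And>u v. u \<in> {1..k} \<Longrightarrow> v \<in> {1..k} \<Longrightarrow> {u, v} \<in> F \<longleftrightarrow> {\<phi> u, \<phi> v} \<in> G"
    and sym: "\<And>i j. i \<in> {1..k} \<Longrightarrow> j \<in> {1..k} \<Longrightarrow> W (v i, v j) = W (v j, v i)"
  shows "edge_product k G W v = edge_product k F W (v \<circ> \<phi>)"
proof -
  have ends: "W (v (Min {i, j}), v (Max {i, j})) = W (v i, v j)" if "i \<in> {1..k}" "j \<in> {1..k}" for i j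
  proof (cases "i \<le> j")
    case True
    then show ?thesis
      by (simp add: min_def max_def)
  next
    case False
    then show ?thesis
      using sym[OF that(2,1)] by (simp add: min_def max_def)
  qed
  define t where "t e = (if e \<in> G then W (v (Min e), v (Max e)) else 1 - W (v (Min e), v (Max e)))" for e
  have "edge_product k G W v = (\<Prod>e\<in>nsets {1..k} 2. t e)"
    by (simp only: edge_product_nsets t_def)
  also have "\<dots> = (\<Prod>e\<in>nsets {1..k} 2. t (\<phi> ` e))"
    by (rule prod.reindex_bij_betw[OF bij_betw_nsets[OF bij], symmetric])
  also have "\<dots> = edge_product k F W (v \<circ> \<phi>)"
    unfolding edge_product_nsets
  proof (rule prod.cong)
    fix e assume "e \<in> nsets {1..k} 2"
    then obtain i j where e: "e = {i, j}" "i \<in> {1..k}" "j \<in> {1..k}" "i < j"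
      unfolding ordered_nsets_2_eq by blast
    have "\<phi> i \<in> {1..k}" "\<phi> j \<in> {1..k}"
      using e(2,3) bij_betwE[OF bij] by blast+
    then have "W (v (Min (\<phi> ` e)), v (Max (\<phi> ` e))) = W (v (\<phi> i), v (\<phi> j))"
      using ends[of "\<phi> i" "\<phi> j"] by (simp only: e(1) image_insert image_empty)
    moreover have "\<phi> ` e \<in> G \<longleftrightarrow> e \<in> F"
      using iso[OF e(2,3)] by (simp only: e(1) image_insert image_empty)
    moreover have "Min e = i" "Max e = j"
      using e(4) by (simp_all add: e(1) min_def max_def)
    ultimately show "t (\<phi> ` e) = (if e \<in> F then W ((v \<circ> \<phi>) (Min e), (v \<circ> \<phi>) (Max e))
         else 1 - W ((v \<circ> \<phi>) (Min e), (v \<circ> \<phi>) (Max e)))"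
      by (simp only: t_def comp_apply)
  qed simp
  finally show ?thesis .
qed

section \<open>Estimates and measurability of the integrand\<close>

definition unit_valued :: "'a measure \<Rightarrow> ('a \<times> 'a \<Rightarrow> real) \<Rightarrow> bool" where
  "unit_valued M W \<longleftrightarrow> (\<forall>z\<in>space (M \<Otimes>\<^sub>M M). 0 \<le> W z \<and> W z \<le> 1)"

lemma space_update:
  assumes "p \<in> space (PiM ({1..k} - {a, b}) (\<lambda>_. M))" "x \<in> space M" "y \<in> space M"
  shows "p(a := x, b := y) \<in> {1..k} \<rightarrow> space M"
proof (rule Pi_I)
  fix i assume "i \<in> {1..k}"
  then show "(p(a := x, b := y)) i \<in> space M"
    using assms PiE_mem[of p "{1..k} - {a, b}" "\<lambda>_. space M" i] by (auto simp: space_PiM)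
qed

lemma edge_product_unit:
  assumes "unit_valued M W" and "v \<in> {1..k} \<rightarrow> space M"
  shows "0 \<le> edge_product k F W v" and "edge_product k F W v \<le> 1"
proof -
  have W: "0 \<le> W (v (fst e), v (snd e)) \<and> W (v (fst e), v (snd e)) \<le> 1" if "e \<in> vertex_pairs k" for e
    using assms(1) that Pi_mem[OF assms(2), of "fst e"] Pi_mem[OF assms(2), of "snd e"]
    by (auto simp: unit_valued_def space_pair_measure vertex_pairs_def)
  show "0 \<le> edge_product k F W v"
    unfolding edge_product_def using W by (intro prod_nonneg) auto
  show "edge_product k F W v \<le> 1"
    unfolding edge_product_def using W by (intro prod_le_1) auto
qed

text \<open>Two products of factors in [0, 1] differ by at most the sum of the differences of their
  factors, and each vertex pair contributes a single factor, W or 1 - W.\<close>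

lemma edge_product_lipschitz:
  fixes d :: real
  assumes "unit_valued M W" "unit_valued M W'" and v: "v \<in> {1..k} \<rightarrow> space M"
    and d: "\<And>z. z \<in> space (M \<Otimes>\<^sub>M M) \<Longrightarrow> \<bar>W z - W' z\<bar> \<le> d"
  shows "\<bar>edge_product k F W v - edge_product k F W' v\<bar> \<le> card (vertex_pairs k) * d"
proof -
  let ?f = "\<lambda>W e. if {fst e, snd e} \<in> F then W (v (fst e), v (snd e)) else 1 - W (v (fst e), v (snd e))"
  have in_space: "(v (fst e), v (snd e)) \<in> space (M \<Otimes>\<^sub>M M)" if "e \<in> vertex_pairs k" for e
    using that Pi_mem[OF v, of "fst e"] Pi_mem[OF v, of "snd e"]
    by (auto simp: space_pair_measure vertex_pairs_def)
  have "norm (edge_product k F W v - edge_product k F W' v) \<le> (\<Sum>e\<in>vertex_pairs k. norm (?f W e - ?f W' e))"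
    unfolding edge_product_def
    using assms(1,2) in_space by (intro norm_prod_diff) (auto simp: unit_valued_def abs_le_iff)
  also have "\<dots> \<le> (\<Sum>e\<in>vertex_pairs k. d)"
    using d[OF in_space] by (intro sum_mono) (auto simp: abs_minus_commute[of "W' _" "W _"])
  finally show ?thesis
    by simp
qed

text \<open>Here q is ((s, (x, y)), p): a parameter s, the root positions x and y, and the positions
  p of the other vertices.\<close>

lemma measurable_update_component:
  assumes "i \<in> {1..k}"
  shows "(\<lambda>q. ((snd q)(a := fst (snd (fst q)), b := snd (snd (fst q)))) i)
    \<in> measurable ((N \<Otimes>\<^sub>M (M \<Otimes>\<^sub>M M)) \<Otimes>\<^sub>M PiM ({1..k} - {a, b}) (\<lambda>_. M)) M"
proof -
  consider "i = b" | "i = a" "i \<noteq> b" | "i \<in> {1..k} - {a, b}"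
    using assms by blast
  then show ?thesis
  proof cases
    case 3
    have "(\<lambda>q. (snd q) i) \<in> measurable ((N \<Otimes>\<^sub>M (M \<Otimes>\<^sub>M M)) \<Otimes>\<^sub>M PiM ({1..k} - {a, b}) (\<lambda>_. M)) M"
      by (rule measurable_compose[OF measurable_snd measurable_component_singleton[OF 3]])
    then show ?thesis
      using 3 by simp
  qed simp_all
qed

text \<open>The parameter in N is time when the Picard iteration is served, and a point of a
  one-element space when a single kernel is meant.\<close>

lemma measurable_edge_product_joint:
  assumes U: "(\<lambda>q. U (fst q) (snd q)) \<in> borel_measurable (N \<Otimes>\<^sub>M (M \<Otimes>\<^sub>M M))"
  shows "(\<lambda>q. edge_product k F (U (fst (fst q))) ((snd q)(a := fst (snd (fst q)), b := snd (snd (fst q)))))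
    \<in> borel_measurable ((N \<Otimes>\<^sub>M (M \<Otimes>\<^sub>M M)) \<Otimes>\<^sub>M PiM ({1..k} - {a, b}) (\<lambda>_. M))"
  unfolding edge_product_def
proof (rule borel_measurable_prod)
  fix e assume e: "e \<in> vertex_pairs k"
  let ?v = "\<lambda>q. (snd q)(a := fst (snd (fst q)), b := snd (snd (fst q)))"
  have "fst e \<in> {1..k}" "snd e \<in> {1..k}"
    using e by (auto simp: vertex_pairs_def)
  note [measurable] = this[THEN measurable_update_component[where M=M and N=N and a=a and b=b]]
  have "(\<lambda>q. (fst (fst q), (?v q (fst e), ?v q (snd e)))) \<in>
    measurable ((N \<Otimes>\<^sub>M (M \<Otimes>\<^sub>M M)) \<Otimes>\<^sub>M PiM ({1..k} - {a, b}) (\<lambda>_. M)) (N \<Otimes>\<^sub>M (M \<Otimes>\<^sub>M M))"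
    by measurable
  from measurable_compose[OF this U]
  have "(\<lambda>q. U (fst (fst q)) (?v q (fst e), ?v q (snd e))) \<in>
      borel_measurable ((N \<Otimes>\<^sub>M (M \<Otimes>\<^sub>M M)) \<Otimes>\<^sub>M PiM ({1..k} - {a, b}) (\<lambda>_. M))"
    by simp
  then show "(\<lambda>q. if {fst e, snd e} \<in> F then U (fst (fst q)) (?v q (fst e), ?v q (snd e))
      else 1 - U (fst (fst q)) (?v q (fst e), ?v q (snd e))) \<in>
      borel_measurable ((N \<Otimes>\<^sub>M (M \<Otimes>\<^sub>M M)) \<Otimes>\<^sub>M PiM ({1..k} - {a, b}) (\<lambda>_. M))"
    by (cases "{fst e, snd e} \<in> F") simp_all
qed

lemma measurable_edge_product:
  assumes W: "W \<in> borel_measurable (M \<Otimes>\<^sub>M M)" and "x \<in> space M" "y \<in> space M"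
  shows "(\<lambda>p. edge_product k F W (p(a := x, b := y))) \<in> borel_measurable (PiM ({1..k} - {a, b}) (\<lambda>_. M))"
proof -
  let ?N = "count_space (UNIV :: unit set)"
  have "(\<lambda>q. W (snd q)) \<in> borel_measurable (?N \<Otimes>\<^sub>M (M \<Otimes>\<^sub>M M))"
    by (rule measurable_compose[OF measurable_snd W])
  then have 1: "(\<lambda>q. edge_product k F W ((snd q)(a := fst (snd (fst q)), b := snd (snd (fst q)))))
    \<in> borel_measurable ((?N \<Otimes>\<^sub>M (M \<Otimes>\<^sub>M M)) \<Otimes>\<^sub>M PiM ({1..k} - {a, b}) (\<lambda>_. M))"
    by (rule measurable_edge_product_joint[where U="\<lambda>_. W"])
  have "(\<lambda>p. (((), (x, y)), p)) \<in> measurable (PiM ({1..k} - {a, b}) (\<lambda>_. M))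
      ((?N \<Otimes>\<^sub>M (M \<Otimes>\<^sub>M M)) \<Otimes>\<^sub>M PiM ({1..k} - {a, b}) (\<lambda>_. M))"
    using assms(2,3) by (intro measurable_Pair1') (simp add: space_pair_measure)
  from measurable_compose[OF this 1] show ?thesis
    by simp
qed

context prob_space
begin

lemma prob_space_PiM_const: "prob_space (PiM I (\<lambda>_. M))"
  by (rule prob_space_PiM) (rule prob_space_axioms)

lemma integrable_edge_product:
  assumes "W \<in> borel_measurable (M \<Otimes>\<^sub>M M)" "unit_valued M W" "x \<in> space M" "y \<in> space M"
  shows "integrable (PiM ({1..k} - {a, b}) (\<lambda>_. M)) (\<lambda>p. edge_product k F W (p(a := x, b := y)))"
proof -
  interpret P: prob_space "PiM ({1..k} - {a, b}) (\<lambda>_. M)"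
    by (rule prob_space_PiM_const)
  show ?thesis
  proof (rule P.integrable_const_bound[where B=1])
    show "AE p in PiM ({1..k} - {a, b}) (\<lambda>_. M). norm (edge_product k F W (p(a := x, b := y))) \<le> 1"
    proof (rule AE_I2)
      fix p assume "p \<in> space (PiM ({1..k} - {a, b}) (\<lambda>_. M))"
      then show "norm (edge_product k F W (p(a := x, b := y))) \<le> 1"
        using edge_product_unit[OF assms(2) space_update[OF _ assms(3,4)]] by simp
    qed
  qed (rule measurable_edge_product[OF assms(1,3,4)])
qed

lemma rooted_density_unit:
  assumes "W \<in> borel_measurable (M \<Otimes>\<^sub>M M)" "unit_valued M W" "z \<in> space (M \<Otimes>\<^sub>M M)"
  shows "0 \<le> rooted_density M k X W z" and "rooted_density M k X W z \<le> 1"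
proof -
  obtain F a b x y where [simp]: "X = (F, a, b)" "z = (x, y)"
    by (metis prod.exhaust)
  have xy: "x \<in> space M" "y \<in> space M"
    using assms(3) by (auto simp: space_pair_measure)
  interpret P: prob_space "PiM ({1..k} - {a, b}) (\<lambda>_. M)"
    by (rule prob_space_PiM_const)
  have unit: "0 \<le> edge_product k F W (p(a := x, b := y))" "edge_product k F W (p(a := x, b := y)) \<le> 1"
    if "p \<in> space (PiM ({1..k} - {a, b}) (\<lambda>_. M))" for p
    using edge_product_unit[OF assms(2) space_update[OF that xy]] by auto
  show "0 \<le> rooted_density M k X W z"
    using unit by (auto simp: rooted_density_eq intro!: Bochner_Integration.integral_nonneg)
  show "rooted_density M k X W z \<le> 1"
    using unit integrable_edge_product[OF assms(1,2) xy]
    by (auto simp: rooted_density_eq intro!: P.integral_le_const)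
qed

lemma rooted_density_lipschitz:
  fixes d :: real
  assumes "W \<in> borel_measurable (M \<Otimes>\<^sub>M M)" "unit_valued M W"
    "W' \<in> borel_measurable (M \<Otimes>\<^sub>M M)" "unit_valued M W'"
    "z \<in> space (M \<Otimes>\<^sub>M M)" "\<And>z. z \<in> space (M \<Otimes>\<^sub>M M) \<Longrightarrow> \<bar>W z - W' z\<bar> \<le> d"
  shows "\<bar>rooted_density M k X W z - rooted_density M k X W' z\<bar> \<le> card (vertex_pairs k) * d"
proof -
  obtain F a b x y where [simp]: "X = (F, a, b)" "z = (x, y)"
    by (metis prod.exhaust)
  have xy: "x \<in> space M" "y \<in> space M"
    using assms(5) by (auto simp: space_pair_measure)
  interpret P: prob_space "PiM ({1..k} - {a, b}) (\<lambda>_. M)"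
    by (rule prob_space_PiM_const)
  note int = integrable_edge_product[OF assms(1,2) xy] integrable_edge_product[OF assms(3,4) xy]
  let ?h = "\<lambda>p. edge_product k F W (p(a := x, b := y)) - edge_product k F W' (p(a := x, b := y))"
  have eq: "rooted_density M k X W z - rooted_density M k X W' z = (\<integral>p. ?h p \<partial>PiM ({1..k} - {a, b}) (\<lambda>_. M))"
    by (subst Bochner_Integration.integral_diff[OF int]) (simp add: rooted_density_eq)
  have "\<bar>rooted_density M k X W z - rooted_density M k X W' z\<bar>
      \<le> (\<integral>p. \<bar>?h p\<bar> \<partial>PiM ({1..k} - {a, b}) (\<lambda>_. M))"
    unfolding eq by (rule integral_abs_bound)
  also have "\<dots> \<le> card (vertex_pairs k) * d"
  proof (rule P.integral_le_const)
    show "integrable (PiM ({1..k} - {a, b}) (\<lambda>_. M)) (\<lambda>p. \<bar>?h p\<bar>)"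
      by (rule integrable_abs[OF Bochner_Integration.integrable_diff[OF int]])
    show "AE p in PiM ({1..k} - {a, b}) (\<lambda>_. M). \<bar>?h p\<bar> \<le> card (vertex_pairs k) * d"
    proof (rule AE_I2)
      fix p assume "p \<in> space (PiM ({1..k} - {a, b}) (\<lambda>_. M))"
      then show "\<bar>?h p\<bar> \<le> card (vertex_pairs k) * d"
        by (rule edge_product_lipschitz[OF assms(2,4) space_update[OF _ xy] assms(6)])
    qed
  qed
  finally show ?thesis .
qed

lemma measurable_rooted_density_joint:
  assumes U: "(\<lambda>(s, z). U s z) \<in> borel_measurable (N \<Otimes>\<^sub>M (M \<Otimes>\<^sub>M M))"
  shows "(\<lambda>(s, z). rooted_density M k X (U s) z) \<in> borel_measurable (N \<Otimes>\<^sub>M (M \<Otimes>\<^sub>M M))"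
proof -
  obtain F a b where [simp]: "X = (F, a, b)"
    by (metis prod.exhaust)
  interpret P: prob_space "PiM ({1..k} - {a, b}) (\<lambda>_. M)"
    by (rule prob_space_PiM_const)
  have "(\<lambda>w. \<integral>p. edge_product k F (U (fst w)) (p(a := fst (snd w), b := snd (snd w)))
      \<partial>PiM ({1..k} - {a, b}) (\<lambda>_. M)) \<in> borel_measurable (N \<Otimes>\<^sub>M (M \<Otimes>\<^sub>M M))"
    using measurable_edge_product_joint[of U N M k F a b] U
    by (intro P.borel_measurable_lebesgue_integral) (simp add: case_prod_beta)
  moreover have "(\<lambda>(s, z). rooted_density M k X (U s) z) = (\<lambda>w. \<integral>p. edge_product k F (U (fst w))
      (p(a := fst (snd w), b := snd (snd w))) \<partial>PiM ({1..k} - {a, b}) (\<lambda>_. M))"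
    by (auto simp: rooted_density_eq)
  ultimately show ?thesis
    by simp
qed

lemma measurable_rooted_density:
  assumes "W \<in> borel_measurable (M \<Otimes>\<^sub>M M)"
  shows "rooted_density M k X W \<in> borel_measurable (M \<Otimes>\<^sub>M M)"
proof -
  let ?N = "count_space (UNIV :: unit set)"
  have "(\<lambda>(s, z). W z) \<in> borel_measurable (?N \<Otimes>\<^sub>M (M \<Otimes>\<^sub>M M))"
    unfolding case_prod_beta by (rule measurable_compose[OF measurable_snd assms])
  from measurable_rooted_density_joint[OF this]
  have 1: "(\<lambda>(s, z). rooted_density M k X W z) \<in> borel_measurable (?N \<Otimes>\<^sub>M (M \<Otimes>\<^sub>M M))" .
  have "Pair () \<in> measurable (M \<Otimes>\<^sub>M M) (?N \<Otimes>\<^sub>M (M \<Otimes>\<^sub>M M))"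
    by (rule measurable_Pair1') simp
  from measurable_compose[OF this 1] show ?thesis
    by simp
qed

lemma rooted_density_cong:
  assumes "X \<in> rooted_graphs k" "z \<in> space (M \<Otimes>\<^sub>M M)" "\<And>z. z \<in> space (M \<Otimes>\<^sub>M M) \<Longrightarrow> W z = W' z"
  shows "rooted_density M k X W z = rooted_density M k X W' z"
proof -
  obtain F a b x y where [simp]: "X = (F, a, b)" "z = (x, y)"
    by (metis prod.exhaust)
  have xy: "x \<in> space M" "y \<in> space M"
    using assms(2) by (auto simp: space_pair_measure)
  have "edge_product k F W (p(a := x, b := y)) = edge_product k F W' (p(a := x, b := y))"
    if "p \<in> space (PiM ({1..k} - {a, b}) (\<lambda>_. M))" for p
  proof (rule edge_product_cong[OF refl], rule assms(3))
    fix i j assume "(i, j) \<in> vertex_pairs k"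
    then show "((p(a := x, b := y)) i, (p(a := x, b := y)) j) \<in> space (M \<Otimes>\<^sub>M M)"
      using Pi_mem[OF space_update[OF that xy]] by (simp add: vertex_pairs_def space_pair_measure)
  qed
  then show ?thesis
    by (simp add: rooted_density_eq cong: Bochner_Integration.integral_cong)
qed

text \<open>All coordinates have the same law M, so renaming the integration variables along \<phi>
  preserves the product measure; the integrands then match by
  \<open>edge_product_iso\<close>.\<close>

lemma rooted_density_iso:
  assumes iso: "(X, Y) \<in> rooted_iso k" and W: "W \<in> kernels M" and z: "z \<in> space (M \<Otimes>\<^sub>M M)"
  shows "rooted_density M k X W z = rooted_density M k Y W z"
proof -
  obtain F a b G c d \<phi> where X[simp]: "X = (F, a, b)" and Y[simp]: "Y = (G, c, d)"
    and rg: "(F, a, b) \<in> rooted_graphs k" "(G, c, d) \<in> rooted_graphs k"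
    and \<phi>: "bij_betw \<phi> {1..k} {1..k}" "\<And>u v. u \<in> {1..k} \<Longrightarrow> v \<in> {1..k} \<Longrightarrow> {u, v} \<in> F \<longleftrightarrow> {\<phi> u, \<phi> v} \<in> G"
      "\<phi> a = c" "\<phi> b = d"
    using iso by (auto simp: rooted_iso_def)
  obtain x y where [simp]: "z = (x, y)"
    by (metis prod.exhaust)
  have xy: "x \<in> space M" "y \<in> space M"
    using z by (auto simp: space_pair_measure)
  have inj: "inj_on \<phi> {1..k}" and ab: "a \<in> {1..k}" "b \<in> {1..k}" "a \<noteq> b"
    using \<phi>(1) rg by (auto simp: bij_betw_def dest: rooted_graphsD)
  have in_range: "\<phi> i \<in> {1..k}" and eq_iff: "\<phi> i = \<phi> j \<longleftrightarrow> i = j"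
    if "i \<in> {1..k}" "j \<in> {1..k}" for i j
    using bij_betwE[OF \<phi>(1)] inj_on_eq_iff[OF inj] that by auto
  let ?I = "{1..k} - {a, b}" and ?K = "{1..k} - {c, d}"
  let ?t = "\<lambda>q. \<lambda>n\<in>?I. q (\<phi> n)"
  have into: "\<phi> \<in> ?I \<rightarrow> ?K"
    using in_range eq_iff ab \<phi>(3,4) by blast
  have distr: "distr (PiM ?K (\<lambda>_. M)) (PiM ?I (\<lambda>_. M)) ?t = PiM ?I (\<lambda>_. M)"
    using into inj by (intro distr_PiM_reindex prob_space_axioms) (auto intro: inj_on_subset)
  have t: "?t \<in> measurable (PiM ?K (\<lambda>_. M)) (PiM ?I (\<lambda>_. M))"
    using into by (intro measurable_restrict measurable_component_singleton) auto
  have Wm: "W \<in> borel_measurable (M \<Otimes>\<^sub>M M)"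
    using W by (simp add: kernels_def)
  have "rooted_density M k X W z =
      (\<integral>q. edge_product k F W ((?t q)(a := x, b := y)) \<partial>PiM ?K (\<lambda>_. M))"
    unfolding X \<open>z = (x, y)\<close> rooted_density_eq
    by (subst distr[symmetric], subst integral_distr[OF t measurable_edge_product[OF Wm xy]]) simp
  also have "\<dots> = (\<integral>q. edge_product k G W (q(c := x, d := y)) \<partial>PiM ?K (\<lambda>_. M))"
  proof (rule Bochner_Integration.integral_cong[OF refl])
    fix q assume q: "q \<in> space (PiM ?K (\<lambda>_. M))"
    have "edge_product k G W (q(c := x, d := y)) = edge_product k F W ((q(c := x, d := y)) \<circ> \<phi>)"
    proof (rule edge_product_iso[OF \<phi>(1,2)])
      fix i j assume "i \<in> {1..k}" "j \<in> {1..k}"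
      then have "(q(c := x, d := y)) i \<in> space M" "(q(c := x, d := y)) j \<in> space M"
        using Pi_mem[OF space_update[OF q xy]] by blast+
      then show "W ((q(c := x, d := y)) i, (q(c := x, d := y)) j) =
          W ((q(c := x, d := y)) j, (q(c := x, d := y)) i)"
        using W by (simp add: kernels_def)
    qed
    also have "\<dots> = edge_product k F W ((?t q)(a := x, b := y))"
    proof (rule edge_product_cong[OF _ refl])
      fix i assume "i \<in> {1..k}"
      then show "((q(c := x, d := y)) \<circ> \<phi>) i = ((?t q)(a := x, b := y)) i"
        using eq_iff[of i a] eq_iff[of i b] ab \<phi>(3,4) by auto
    qed
    finally show "edge_product k F W ((?t q)(a := x, b := y)) = edge_product k G W (q(c := x, d := y))"
      by simp
  qed
  finally show ?thesis
    by (simp add: rooted_density_eq)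
qed

text \<open>Two distinct coordinates of the product are jointly distributed as a pair of independent
  points. Coordinate i is split off; for almost every value x of it the sections of W and W' at x
  agree almost everywhere, and this passes to coordinate j of the remaining product.\<close>

lemma AE_PiM_pair:
  assumes W: "W \<in> borel_measurable (M \<Otimes>\<^sub>M M)" and W': "W' \<in> borel_measurable (M \<Otimes>\<^sub>M M)"
    and eq: "AE z in M \<Otimes>\<^sub>M M. W z = (W' z :: real)" and ij: "i \<in> I" "j \<in> I" "i \<noteq> j"
  shows "AE v in PiM I (\<lambda>_. M). W (v i, v j) = W' (v i, v j)"
proof -
  interpret J: prob_space "PiM (I - {i}) (\<lambda>_. M)"
    by (rule prob_space_PiM_const)
  interpret pair_sigma_finite M "PiM (I - {i}) (\<lambda>_. M)" ..
  interpret MM: pair_sigma_finite M M ..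
  note [measurable] = W W'
  have j[measurable]: "(\<lambda>v. v j) \<in> measurable (PiM (I - {i}) (\<lambda>_. M)) M"
    using ij by (intro measurable_component_singleton) auto
  have "AE x in M. AE v in PiM (I - {i}) (\<lambda>_. M). W (x, v j) = W' (x, v j)"
    using MM.AE_pair[OF eq]
  proof (rule eventually_mono)
    fix x assume "AE y in M. W (x, y) = W' (x, y)"
    then show "AE v in PiM (I - {i}) (\<lambda>_. M). W (x, v j) = W' (x, v j)"
      using ij by (intro AE_PiM_component[where P="\<lambda>y. W (x, y) = W' (x, y)"] prob_space_axioms) auto
  qed
  then have "AE q in M \<Otimes>\<^sub>M PiM (I - {i}) (\<lambda>_. M). W (fst q, (snd q) j) = W' (fst q, (snd q) j)"
    by (intro AE_pair_measure) measurable
  then have AE: "AE q in M \<Otimes>\<^sub>M PiM (I - {i}) (\<lambda>_. M).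
      W ((case q of (x, X) \<Rightarrow> X(i := x)) i, (case q of (x, X) \<Rightarrow> X(i := x)) j) =
      W' ((case q of (x, X) \<Rightarrow> X(i := x)) i, (case q of (x, X) \<Rightarrow> X(i := x)) j)"
    using ij by (simp add: case_prod_beta)
  have I: "insert i (I - {i}) = I"
    using ij by auto
  have distr: "distr (M \<Otimes>\<^sub>M PiM (I - {i}) (\<lambda>_. M)) (PiM I (\<lambda>_. M)) (\<lambda>(x, X). X(i := x)) = PiM I (\<lambda>_. M)"
    using distr_pair_PiM_eq_PiM[of "I - {i}" "\<lambda>_. M" i, OF prob_space_axioms prob_space_axioms]
    by (simp only: I)
  have upd: "(\<lambda>(x, X). X(i := x)) \<in> measurable (M \<Otimes>\<^sub>M PiM (I - {i}) (\<lambda>_. M)) (PiM I (\<lambda>_. M))"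
    unfolding case_prod_beta
    by (rule measurable_fun_upd[where J="I - {i}"]) (use ij(1) in auto)
  have [measurable]: "(\<lambda>v. v i) \<in> measurable (PiM I (\<lambda>_. M)) M" "(\<lambda>v. v j) \<in> measurable (PiM I (\<lambda>_. M)) M"
    using ij by (simp_all add: measurable_component_singleton)
  have "{v \<in> space (PiM I (\<lambda>_. M)). W (v i, v j) = W' (v i, v j)} \<in> sets (PiM I (\<lambda>_. M))"
    by measurable
  then have "AE v in distr (M \<Otimes>\<^sub>M PiM (I - {i}) (\<lambda>_. M)) (PiM I (\<lambda>_. M)) (\<lambda>(x, X). X(i := x)).
      W (v i, v j) = W' (v i, v j)"
    using AE by (simp only: AE_distr_iff[OF upd])
  then show ?thesis
    by (simp only: distr)
qed

text \<open>A trajectory starts at some representative of its initial kernel, so the velocity has to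
  respect equality almost everywhere. The two root coordinates are split off from the product over
  all vertices by Fubini, one after the other.\<close>

lemma AE_rooted_density_cong:
  assumes W: "W \<in> borel_measurable (M \<Otimes>\<^sub>M M)" and W': "W' \<in> borel_measurable (M \<Otimes>\<^sub>M M)"
    and eq: "AE z in M \<Otimes>\<^sub>M M. W z = W' z" and X: "X \<in> rooted_graphs k"
  shows "AE z in M \<Otimes>\<^sub>M M. rooted_density M k X W z = rooted_density M k X W' z"
proof -
  obtain F a b where Xeq: "X = (F, a, b)"
    by (metis prod.exhaust)
  have ab: "a \<in> {1..k}" "b \<in> {1..k}" "a \<noteq> b"
    using X by (auto simp: Xeq dest: rooted_graphsD)
  let ?P = "\<lambda>I. PiM I (\<lambda>_. M)" and ?I = "{1..k} - {a, b}"
  have insertE: "AE x in M. AE p in ?P I. Q (p(i := x))" if "AE v in ?P (insert i I). Q v" for Q i I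
  proof -
    interpret I: prob_space "?P I"
      by (rule prob_space_PiM_const)
    interpret pair_sigma_finite M "?P I" ..
    have upd: "(\<lambda>(x, X). X(i := x)) \<in> measurable (M \<Otimes>\<^sub>M ?P I) (?P (insert i I))"
      unfolding case_prod_beta by (rule measurable_fun_upd[where J=I]) auto
    have "AE q in M \<Otimes>\<^sub>M ?P I. Q ((\<lambda>(x, X). X(i := x)) q)"
      by (rule AE_distrD[OF upd])
        (use that in \<open>simp only: distr_pair_PiM_eq_PiM[OF prob_space_axioms prob_space_axioms]\<close>)
    from AE_pair[OF this] show ?thesis
      by simp
  qed
  define D where "D v \<longleftrightarrow> (\<forall>e\<in>vertex_pairs k. W (v (fst e), v (snd e)) = W' (v (fst e), v (snd e)))" for v
  have D_imp: "edge_product k F W v = edge_product k F W' v" if "D v" for v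
    unfolding edge_product_def using that by (intro prod.cong) (auto simp: D_def)
  have "AE v in ?P {1..k}. D v"
    unfolding D_def
    by (intro AE_finite_allI finite_vertex_pairs AE_PiM_pair W W' eq) (auto simp: vertex_pairs_def)
  moreover have "{1..k} = insert a (insert b ?I)"
    using ab by auto
  ultimately have "AE v in ?P (insert a (insert b ?I)). D v"
    by metis
  from insertE[OF this]
  have "AE x in M. AE y in M. AE p in ?P ?I. D (p(b := y, a := x))"
  proof (rule eventually_mono)
    fix x assume "AE p in ?P (insert b ?I). D (p(a := x))"
    from insertE[OF this] show "AE y in M. AE p in ?P ?I. D (p(b := y, a := x))" .
  qed
  then have "AE x in M. AE y in M. rooted_density M k X W (x, y) = rooted_density M k X W' (x, y)"
    using AE_space
  proof eventually_elim
    case (elim x)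
    from elim(1) AE_space show ?case
    proof eventually_elim
      case (elim y)
      have upd: "p(b := y, a := x) = p(a := x, b := y)" for p :: "nat \<Rightarrow> 'a"
        using ab(3) by (rule fun_upd_twist[symmetric])
      have "AE p in ?P ?I. edge_product k F W (p(a := x, b := y)) = edge_product k F W' (p(a := x, b := y))"
        using elim(1) by (rule eventually_mono) (simp only: upd D_imp)
      then show ?case
        unfolding Xeq rooted_density_eq
        by (rule integral_cong_AE[OF measurable_edge_product[OF W \<open>x \<in> space M\<close> elim(2)]
              measurable_edge_product[OF W' \<open>x \<in> space M\<close> elim(2)]])
    qed
  qed
  moreover interpret pair_sigma_finite M M ..
  note [measurable] = measurable_rooted_density[OF W] measurable_rooted_density[OF W']
  have "{z \<in> space (M \<Otimes>\<^sub>M M). rooted_density M k X W z = rooted_density M k X W' z} \<in> sets (M \<Otimes>\<^sub>M M)"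
    by measurable
  ultimately show ?thesis
    by (intro AE_pair_measure)
qed

end

section \<open>Velocities and trajectories\<close>

text \<open>If f t < 0, then f is negative after the last earlier time s with f s \<ge> 0, so by the
  mean value theorem it cannot decrease from s to t. The sign condition concerns only times with f <
  0. There a truncated kernel sits exactly on the boundary of [0, 1], where the sign of the velocity
  is known.\<close>

lemma derivative_barrier:
  fixes f f' :: "real \<Rightarrow> real"
  assumes deriv: "\<And>t. 0 \<le> t \<Longrightarrow> (f has_real_derivative f' t) (at t within {0..})"
    and "0 \<le> f 0" and push: "\<And>t. 0 \<le> t \<Longrightarrow> f t < 0 \<Longrightarrow> 0 \<le> f' t" and "0 \<le> t"
  shows "0 \<le> f t"
proof (rule ccontr)
  assume neg: "\<not> 0 \<le> f t"
  have "continuous_on {0..} f"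
    using deriv by (intro DERIV_continuous_on[where D=f']) auto
  then have cont: "continuous_on {0..t} f"
    by (rule continuous_on_subset) auto
  have "closed ({0..t} \<inter> f -` {0..})"
    by (intro continuous_closed_preimage cont) auto
  then have "compact ({0..t} \<inter> ({0..t} \<inter> f -` {0..}))"
    by (intro compact_Int_closed compact_Icc)
  moreover have "0 \<in> {0..t} \<inter> ({0..t} \<inter> f -` {0..})"
    using assms by auto
  ultimately obtain s where s: "s \<in> {0..t} \<inter> ({0..t} \<inter> f -` {0..})"
    and max: "\<And>r. r \<in> {0..t} \<inter> ({0..t} \<inter> f -` {0..}) \<Longrightarrow> r \<le> s"
    using compact_attains_sup by (metis empty_iff)
  have "s < t"
    using s neg by (cases "s = t") auto
  have "\<exists>\<xi>\<in>{s<..<t}. f t - f s = (\<lambda>h. f' \<xi> * h) (t - s)"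
  proof (rule mvt_simple[OF \<open>s < t\<close>])
    fix x assume "s \<le> x" "x \<le> t"
    then have "(f has_real_derivative f' x) (at x within {s..t})"
      using s by (intro DERIV_subset[OF deriv]) auto
    then show "(f has_derivative (\<lambda>h. f' x * h)) (at x within {s..t})"
      by (simp add: has_field_derivative_def)
  qed
  then obtain \<xi> where \<xi>: "s < \<xi>" "\<xi> < t" "f t - f s = f' \<xi> * (t - s)"
    by auto
  have "f \<xi> < 0"
    using max[of \<xi>] \<xi> s by force
  then have "0 \<le> f' \<xi>"
    using push \<xi> s by auto
  then have "f s \<le> f t"
    using \<xi> by (metis diff_ge_0_iff_ge less_imp_le mult_nonneg_nonneg order.strict_trans)
  then show False
    using s neg by auto
qed

text \<open>The factor of the pair of roots does not involve the integration variables, so if it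
  vanishes, so does the integral. Both orders of x and y enter because the factor uses W (x, y) or W
  (y, x) according to which root is smaller.\<close>

lemma rooted_density_zero:
  assumes "(F, a, b) \<in> rooted_graphs k"
    and "{a, b} \<in> F \<and> W (x, y) = 0 \<and> W (y, x) = 0 \<or> {a, b} \<notin> F \<and> W (x, y) = 1 \<and> W (y, x) = 1"
  shows "rooted_density M k (F, a, b) W (x, y) = 0"
proof -
  have ab: "a \<in> {1..k}" "b \<in> {1..k}" "a \<noteq> b"
    using assms(1) by (auto dest: rooted_graphsD)
  have "edge_product k F W (p(a := x, b := y)) = 0" for p
    unfolding edge_product_def
  proof (rule prod_zero)
    show "\<exists>e\<in>vertex_pairs k. (if {fst e, snd e} \<in> F
        then W ((p(a := x, b := y)) (fst e), (p(a := x, b := y)) (snd e))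
        else 1 - W ((p(a := x, b := y)) (fst e), (p(a := x, b := y)) (snd e))) = 0"
    proof (cases "a < b")
      case True
      then show ?thesis
        using ab assms(2) by (intro bexI[of _ "(a, b)"]) (auto simp: vertex_pairs_def)
    next
      case False
      then show ?thesis
        using ab assms(2) by (intro bexI[of _ "(b, a)"]) (auto simp: vertex_pairs_def insert_commute)
    qed
  qed simp
  then show ?thesis
    by (simp add: rooted_density_eq)
qed

text \<open>The sum is the probability that the graph replacing F has the edge between a and b, so a
  non-edge can only gain and an edge can only lose.\<close>

lemma root_change_bounds:
  assumes R: "is_rule k R" and X: "(F, a, b) \<in> rooted_graphs k"
  shows "{a, b} \<notin> F \<Longrightarrow> 0 \<le> root_change k R (F, a, b)"
    and "{a, b} \<in> F \<Longrightarrow> root_change k R (F, a, b) \<le> 0"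
proof -
  have F: "F \<in> labelled_graphs k"
    using X by (auto dest: rooted_graphsD)
  have pos: "0 \<le> R F H" if "H \<in> labelled_graphs k" for H
    using R F that by (auto simp: is_rule_def)
  have "0 \<le> (\<Sum>H\<in>labelled_graphs k. R F H * of_bool ({a, b} \<in> H))"
    using pos by (intro sum_nonneg) auto
  then show "{a, b} \<notin> F \<Longrightarrow> 0 \<le> root_change k R (F, a, b)"
    by (simp add: root_change_def)
  have "(\<Sum>H\<in>labelled_graphs k. R F H * of_bool ({a, b} \<in> H)) \<le> (\<Sum>H\<in>labelled_graphs k. R F H)"
    using pos by (intro sum_mono) auto
  also have "\<dots> = 1"
    using R F by (auto simp: is_rule_def)
  finally show "{a, b} \<in> F \<Longrightarrow> root_change k R (F, a, b) \<le> 0"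
    by (simp add: root_change_def)
qed

text \<open>Exchanging the roots permutes \<open>rooted_graphs k\<close> and exchanges x and y. This
  is what keeps trajectories symmetric.\<close>

lemma velocity_commute: "velocity M k R W (x, y) = velocity M k R W (y, x)"
  unfolding velocity_def
proof (rule sum.reindex_bij_witness[where i="\<lambda>(F, a, b). (F, b, a)" and j="\<lambda>(F, a, b). (F, b, a)"])
  fix X assume X: "X \<in> rooted_graphs k"
  obtain F a b where [simp]: "X = (F, a, b)"
    by (metis prod.exhaust)
  have "a \<noteq> b"
    using X by (auto dest: rooted_graphsD)
  then have "p(b := y, a := x) = p(a := x, b := y)" for p :: "nat \<Rightarrow> 'a"
    by (rule fun_upd_twist[symmetric])
  moreover have "{1..k} - {b, a} = {1..k} - {a, b}"
    by blast
  ultimately have "rooted_density M k (F, b, a) W (y, x) = rooted_density M k (F, a, b) W (x, y)"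
    unfolding rooted_density_eq by simp
  moreover have "root_change k R (F, b, a) = root_change k R (F, a, b)"
    by (simp add: root_change_def insert_commute)
  ultimately show "root_change k R (case X of (F, a, b) \<Rightarrow> (F, b, a)) *
      rooted_density M k (case X of (F, a, b) \<Rightarrow> (F, b, a)) W (y, x) =
      root_change k R X * rooted_density M k X W (x, y)"
    by simp
qed (auto simp: rooted_graphs_def)

lemma equiv_rooted_iso: "equiv (rooted_graphs k) (rooted_iso k)"
proof (rule equivI)
  show "rooted_iso k \<subseteq> rooted_graphs k \<times> rooted_graphs k"
    by (auto simp: rooted_iso_def)
  show "refl_on (rooted_graphs k) (rooted_iso k)"
  proof (rule refl_onI)
    fix X assume "X \<in> rooted_graphs k"
    then show "(X, X) \<in> rooted_iso k"
      by (auto simp: rooted_iso_def intro!: exI[of _ id])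
  qed
  show "sym (rooted_iso k)"
  proof (rule symI)
    fix X Y assume XY: "(X, Y) \<in> rooted_iso k"
    obtain F a b G c d where [simp]: "X = (F, a, b)" "Y = (G, c, d)"
      by (metis prod.exhaust)
    obtain \<phi> where rg: "(F, a, b) \<in> rooted_graphs k" "(G, c, d) \<in> rooted_graphs k"
      and \<phi>: "bij_betw \<phi> {1..k} {1..k}" "\<And>u v. u \<in> {1..k} \<Longrightarrow> v \<in> {1..k} \<Longrightarrow> {u, v} \<in> F \<longleftrightarrow> {\<phi> u, \<phi> v} \<in> G"
        "\<phi> a = c" "\<phi> b = d"
      using XY by (auto simp: rooted_iso_def)
    let ?\<psi> = "the_inv_into {1..k} \<phi>"
    have inv: "?\<psi> i \<in> {1..k}" "\<phi> (?\<psi> i) = i" if "i \<in> {1..k}" for i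
      using \<phi>(1) that bij_betwE[OF bij_betw_the_inv_into[OF \<phi>(1)]]
      by (auto simp: bij_betw_def f_the_inv_into_f)
    have "?\<psi> c = a" "?\<psi> d = b"
      using \<phi> rg by (auto simp: bij_betw_def the_inv_into_f_f dest!: rooted_graphsD)
    then show "(Y, X) \<in> rooted_iso k"
      using rg bij_betw_the_inv_into[OF \<phi>(1)] inv \<phi>(2)
      unfolding rooted_iso_def by (auto intro!: exI[of _ ?\<psi>])
  qed
  show "trans (rooted_iso k)"
  proof (rule transI)
    fix X Y Z assume XY: "(X, Y) \<in> rooted_iso k" and YZ: "(Y, Z) \<in> rooted_iso k"
    obtain F a b G c d H e f where [simp]: "X = (F, a, b)" "Y = (G, c, d)" "Z = (H, e, f)"
      by (metis prod.exhaust)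
    obtain \<phi> where rg: "(F, a, b) \<in> rooted_graphs k"
      and \<phi>: "bij_betw \<phi> {1..k} {1..k}" "\<And>u v. u \<in> {1..k} \<Longrightarrow> v \<in> {1..k} \<Longrightarrow> {u, v} \<in> F \<longleftrightarrow> {\<phi> u, \<phi> v} \<in> G"
        "\<phi> a = c" "\<phi> b = d"
      using XY by (auto simp: rooted_iso_def)
    obtain \<psi> where rg': "(H, e, f) \<in> rooted_graphs k"
      and \<psi>: "bij_betw \<psi> {1..k} {1..k}" "\<And>u v. u \<in> {1..k} \<Longrightarrow> v \<in> {1..k} \<Longrightarrow> {u, v} \<in> G \<longleftrightarrow> {\<psi> u, \<psi> v} \<in> H"
        "\<psi> c = e" "\<psi> d = f"
      using YZ by (auto simp: rooted_iso_def)
    have "{u, v} \<in> F \<longleftrightarrow> {(\<psi> \<circ> \<phi>) u, (\<psi> \<circ> \<phi>) v} \<in> H" if "u \<in> {1..k}" "v \<in> {1..k}" for u v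
      using \<phi>(2)[OF that] \<psi>(2)[of "\<phi> u" "\<phi> v"] bij_betwE[OF \<phi>(1)] that by simp
    moreover have "(\<psi> \<circ> \<phi>) a = e" "(\<psi> \<circ> \<phi>) b = f"
      using \<phi>(3,4) \<psi>(3,4) by auto
    ultimately show "(X, Z) \<in> rooted_iso k"
      using rg rg' bij_betw_trans[OF \<phi>(1) \<psi>(1)]
      unfolding rooted_iso_def by (auto intro!: exI[of _ "\<psi> \<circ> \<phi>"])
  qed
qed

section \<open>Estimates for the velocity and existence of trajectories\<close>

definition truncate_unit :: "real \<Rightarrow> real" where
  "truncate_unit x = max 0 (min 1 x)"

lemma truncate_unit_measurable [measurable]: "truncate_unit \<in> borel_measurable borel"
  unfolding truncate_unit_def by measurable

lemma truncate_unit_bounds: "0 \<le> truncate_unit x" "truncate_unit x \<le> 1"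
  by (auto simp: truncate_unit_def)

lemma truncate_unit_lipschitz: "\<bar>truncate_unit x - truncate_unit y\<bar> \<le> \<bar>x - y\<bar>"
  by (auto simp: truncate_unit_def)

lemma truncate_unit_id: "0 \<le> x \<Longrightarrow> x \<le> 1 \<Longrightarrow> truncate_unit x = x"
  by (simp add: truncate_unit_def)

context prob_space
begin

lemma velocity_cong:
  assumes "z \<in> space (M \<Otimes>\<^sub>M M)" "\<And>z. z \<in> space (M \<Otimes>\<^sub>M M) \<Longrightarrow> W z = W' z"
  shows "velocity M k R W z = velocity M k R W' z"
  unfolding velocity_def using assms by (intro sum.cong refl arg_cong2[where f=times] rooted_density_cong) auto

lemma measurable_velocity_joint:
  assumes "(\<lambda>(s, z). U s z) \<in> borel_measurable (N \<Otimes>\<^sub>M (M \<Otimes>\<^sub>M M))"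
  shows "(\<lambda>(s, z). velocity M k R (U s) z) \<in> borel_measurable (N \<Otimes>\<^sub>M (M \<Otimes>\<^sub>M M))"
proof -
  have "(\<lambda>q. \<Sum>X\<in>rooted_graphs k. root_change k R X * (case q of (s, z) \<Rightarrow> rooted_density M k X (U s) z))
      \<in> borel_measurable (N \<Otimes>\<^sub>M (M \<Otimes>\<^sub>M M))"
    by (intro borel_measurable_sum borel_measurable_times borel_measurable_const
        measurable_rooted_density_joint assms)
  then show ?thesis
    by (simp add: velocity_def case_prod_beta)
qed

lemma measurable_velocity:
  assumes "W \<in> borel_measurable (M \<Otimes>\<^sub>M M)"
  shows "velocity M k R W \<in> borel_measurable (M \<Otimes>\<^sub>M M)"
  unfolding velocity_def[abs_def]
  by (intro borel_measurable_sum borel_measurable_times borel_measurable_const measurable_rooted_density assms)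

lemma AE_velocity_cong:
  assumes "W \<in> borel_measurable (M \<Otimes>\<^sub>M M)" "W' \<in> borel_measurable (M \<Otimes>\<^sub>M M)"
    and "AE z in M \<Otimes>\<^sub>M M. W z = W' z"
  shows "AE z in M \<Otimes>\<^sub>M M. velocity M k R W z = velocity M k R W' z"
proof -
  have "AE z in M \<Otimes>\<^sub>M M. \<forall>X\<in>rooted_graphs k. rooted_density M k X W z = rooted_density M k X W' z"
    by (intro AE_finite_allI finite_rooted_graphs AE_rooted_density_cong assms)
  then show ?thesis
    by (rule eventually_mono) (simp add: velocity_def)
qed

lemma velocity_bounded:
  assumes "W \<in> borel_measurable (M \<Otimes>\<^sub>M M)" "unit_valued M W" "z \<in> space (M \<Otimes>\<^sub>M M)"
  shows "\<bar>velocity M k R W z\<bar> \<le> (\<Sum>X\<in>rooted_graphs k. \<bar>root_change k R X\<bar>)"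
proof -
  have "\<bar>velocity M k R W z\<bar> \<le> (\<Sum>X\<in>rooted_graphs k. \<bar>root_change k R X * rooted_density M k X W z\<bar>)"
    unfolding velocity_def by (rule sum_abs)
  also have "\<dots> \<le> (\<Sum>X\<in>rooted_graphs k. \<bar>root_change k R X\<bar>)"
    using rooted_density_unit[OF assms] by (intro sum_mono) (simp add: abs_mult mult_left_le)
  finally show ?thesis .
qed

lemma velocity_lipschitz:
  fixes d :: real
  assumes "W \<in> borel_measurable (M \<Otimes>\<^sub>M M)" "unit_valued M W"
    "W' \<in> borel_measurable (M \<Otimes>\<^sub>M M)" "unit_valued M W'"
    "z \<in> space (M \<Otimes>\<^sub>M M)" "\<And>z. z \<in> space (M \<Otimes>\<^sub>M M) \<Longrightarrow> \<bar>W z - W' z\<bar> \<le> d"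
  shows "\<bar>velocity M k R W z - velocity M k R W' z\<bar>
    \<le> (\<Sum>X\<in>rooted_graphs k. \<bar>root_change k R X\<bar>) * card (vertex_pairs k) * d"
proof -
  have "velocity M k R W z - velocity M k R W' z =
      (\<Sum>X\<in>rooted_graphs k. root_change k R X * (rooted_density M k X W z - rooted_density M k X W' z))"
    by (simp add: velocity_def right_diff_distrib sum_subtractf)
  also have "\<bar>\<dots>\<bar> \<le> (\<Sum>X\<in>rooted_graphs k.
      \<bar>root_change k R X * (rooted_density M k X W z - rooted_density M k X W' z)\<bar>)"
    by (rule sum_abs)
  also have "\<dots> \<le> (\<Sum>X\<in>rooted_graphs k. \<bar>root_change k R X\<bar> * (card (vertex_pairs k) * d))"
    unfolding abs_mult by (intro sum_mono mult_left_mono rooted_density_lipschitz assms) auto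
  finally show ?thesis
    by (simp add: sum_distrib_right mult.assoc)
qed

lemma velocity_nonneg_at_zero:
  assumes "is_rule k R" "W \<in> borel_measurable (M \<Otimes>\<^sub>M M)" "unit_valued M W" "(x, y) \<in> space (M \<Otimes>\<^sub>M M)"
    and "W (x, y) = 0" "W (y, x) = 0"
  shows "0 \<le> velocity M k R W (x, y)"
  unfolding velocity_def
proof (rule sum_nonneg)
  fix X assume X: "X \<in> rooted_graphs k"
  obtain F a b where Xeq[simp]: "X = (F, a, b)"
    by (metis prod.exhaust)
  have "0 \<le> rooted_density M k X W (x, y)"
    by (rule rooted_density_unit[OF assms(2-4)])
  then show "0 \<le> root_change k R X * rooted_density M k X W (x, y)"
    using root_change_bounds(1)[OF assms(1) X[unfolded Xeq]]
      rooted_density_zero[OF X[unfolded Xeq], of W x y M] assms(5,6) by (cases "{a, b} \<in> F") auto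
qed

lemma velocity_nonpos_at_one:
  assumes "is_rule k R" "W \<in> borel_measurable (M \<Otimes>\<^sub>M M)" "unit_valued M W" "(x, y) \<in> space (M \<Otimes>\<^sub>M M)"
    and "W (x, y) = 1" "W (y, x) = 1"
  shows "velocity M k R W (x, y) \<le> 0"
  unfolding velocity_def
proof (rule sum_nonpos)
  fix X assume X: "X \<in> rooted_graphs k"
  obtain F a b where Xeq[simp]: "X = (F, a, b)"
    by (metis prod.exhaust)
  have "0 \<le> rooted_density M k X W (x, y)"
    by (rule rooted_density_unit[OF assms(2-4)])
  then show "root_change k R X * rooted_density M k X W (x, y) \<le> 0"
    using root_change_bounds(2)[OF assms(1) X[unfolded Xeq]]
      rooted_density_zero[OF X[unfolded Xeq], of W x y M] assms(5,6)
    by (cases "{a, b} \<in> F") (auto simp: mult_nonpos_nonneg)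
qed

lemma trajectory_exists:
  assumes R: "is_rule k R" and W: "W \<in> graphons M"
  shows "\<exists>u. is_trajectory M k R W u"
proof -
  let ?\<Omega> = "M \<Otimes>\<^sub>M M"
  let ?V = "\<lambda>U. velocity M k R (\<lambda>z. truncate_unit (U z))"
  define C where "C = (\<Sum>X\<in>rooted_graphs k. \<bar>root_change k R X\<bar>)"
  \<comment> \<open>The summand 1 makes L positive even when C is 0 or there are no vertex pairs, as
    for k = 1.\<close>
  define L where "L = C * card (vertex_pairs k) + 1"
  have "0 \<le> C"
    unfolding C_def by (intro sum_nonneg) auto
  then have "0 < L"
    unfolding L_def by (intro add_nonneg_pos mult_nonneg_nonneg) auto
  have unit: "unit_valued M (\<lambda>z. truncate_unit (U z))" for U
    by (simp add: unit_valued_def truncate_unit_bounds)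
  have meas: "(\<lambda>z. truncate_unit (U z)) \<in> borel_measurable ?\<Omega>" if "U \<in> borel_measurable ?\<Omega>" for U
    using that by (rule measurable_compose) measurable
  interpret bounded_lipschitz_field ?\<Omega> ?V C L
  proof
    fix U :: "real \<Rightarrow> 'a \<times> 'a \<Rightarrow> real"
    assume "(\<lambda>(s, z). U s z) \<in> borel_measurable (lborel \<Otimes>\<^sub>M ?\<Omega>)"
    then have "(\<lambda>q. truncate_unit (case q of (s, z) \<Rightarrow> U s z)) \<in> borel_measurable (lborel \<Otimes>\<^sub>M ?\<Omega>)"
      by (rule measurable_compose) measurable
    then have "(\<lambda>(s, z). truncate_unit (U s z)) \<in> borel_measurable (lborel \<Otimes>\<^sub>M ?\<Omega>)"
      by (simp only: case_prod_unfold)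
    then show "(\<lambda>(s, z). ?V (U s) z) \<in> borel_measurable (lborel \<Otimes>\<^sub>M ?\<Omega>)"
      by (rule measurable_velocity_joint)
  next
    fix U :: "'a \<times> 'a \<Rightarrow> real" and z assume "U \<in> borel_measurable ?\<Omega>" "z \<in> space ?\<Omega>"
    then show "\<bar>?V U z\<bar> \<le> C"
      unfolding C_def by (intro velocity_bounded meas unit)
  next
    fix U U' :: "'a \<times> 'a \<Rightarrow> real" and d :: real and z
    assume *: "U \<in> borel_measurable ?\<Omega>" "U' \<in> borel_measurable ?\<Omega>"
      "\<And>y. y \<in> space ?\<Omega> \<Longrightarrow> \<bar>U y - U' y\<bar> \<le> d" "z \<in> space ?\<Omega>"
    have "0 \<le> d"
      using *(3)[OF *(4)] by linarith
    have "\<bar>?V U z - ?V U' z\<bar> \<le> C * card (vertex_pairs k) * d"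
      unfolding C_def
      by (intro velocity_lipschitz meas unit *(1,2,4) order_trans[OF truncate_unit_lipschitz *(3)])
    also have "\<dots> \<le> L * d"
      using \<open>0 \<le> d\<close> by (simp add: L_def distrib_right)
    finally show "\<bar>?V U z - ?V U' z\<bar> \<le> L * d" .
  qed fact+
  have W_meas: "W \<in> borel_measurable ?\<Omega>"
    using W by (simp add: graphons_def kernels_def)
  obtain u where u_meas: "\<And>t. 0 \<le> t \<Longrightarrow> u t \<in> borel_measurable ?\<Omega>"
    and u_0: "\<And>z. z \<in> space ?\<Omega> \<Longrightarrow> u 0 z = W z"
    and u_deriv: "\<And>t z. 0 \<le> t \<Longrightarrow> z \<in> space ?\<Omega> \<Longrightarrow>
      ((\<lambda>s. u s z) has_real_derivative ?V (u t) z) (at t within {0..})"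
    and u_lip: "\<And>s t z. 0 \<le> s \<Longrightarrow> 0 \<le> t \<Longrightarrow> z \<in> space ?\<Omega> \<Longrightarrow> \<bar>u s z - u t z\<bar> \<le> C * \<bar>s - t\<bar>"
    by (rule solution_exists[OF W_meas]) blast
  \<comment> \<open>The difference u s (x, y) - u s (y, x) has derivative 0 by
    \<open>velocity_commute\<close> and starts at 0.\<close>
  have u_sym: "u t (x, y) = u t (y, x)" if "0 \<le> t" "x \<in> space M" "y \<in> space M" for t x y
  proof -
    have xy: "(x, y) \<in> space ?\<Omega>" "(y, x) \<in> space ?\<Omega>"
      using that by (auto simp: space_pair_measure)
    have "((\<lambda>s. u s (x, y) - u s (y, x)) has_real_derivative 0) (at s within {0..})" if "s \<in> {0..}" for s
      using DERIV_diff[OF u_deriv[of s "(x, y)"] u_deriv[of s "(y, x)"]] xy that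
      by (simp add: velocity_commute[of M k R _ x y])
    then obtain c where c: "\<And>s. s \<in> {0..} \<Longrightarrow> u s (x, y) - u s (y, x) = c"
      using has_field_derivative_zero_constant[of "{0..}" "\<lambda>s. u s (x, y) - u s (y, x)"] by auto
    moreover have "u 0 (x, y) - u 0 (y, x) = 0"
      using xy W that by (simp add: u_0 graphons_def kernels_def)
    ultimately show ?thesis
      using c[of 0] c[of t] \<open>0 \<le> t\<close> by simp
  qed
  have u_unit: "0 \<le> u t z \<and> u t z \<le> 1" if "0 \<le> t" and z: "z \<in> space ?\<Omega>" for t z
  proof
    obtain x y where zeq: "z = (x, y)"
      by (metis prod.exhaust)
    have xy: "x \<in> space M" "y \<in> space M"
      using z by (auto simp: zeq space_pair_measure)
    have W01: "0 \<le> W z" "W z \<le> 1"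
      using W z by (auto simp: graphons_def)
    show "0 \<le> u t z"
    proof (rule derivative_barrier[where f="\<lambda>t. u t z" and f'="\<lambda>t. ?V (u t) z"])
      \<comment> \<open>Where u s z < 0, the truncation is 0 at (x, y) and, by symmetry, at (y, x).
        Only rooted graphs whose roots are not adjacent then contribute.\<close>
      fix s :: real assume "0 \<le> s" "u s z < 0"
      then show "0 \<le> ?V (u s) z"
        using u_sym[of s x y] xy z unfolding zeq
        by (intro velocity_nonneg_at_zero[OF R meas[OF u_meas] unit]) (auto simp: truncate_unit_def)
    qed (use u_deriv z u_0 W01 that in auto)
    have "0 \<le> 1 - u t z"
    proof (rule derivative_barrier[where f="\<lambda>t. 1 - u t z" and f'="\<lambda>t. - ?V (u t) z"])
      fix s :: real assume "0 \<le> s" "1 - u s z < 0"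
      then have "?V (u s) z \<le> 0"
        using u_sym[of s x y] xy z unfolding zeq
        by (intro velocity_nonpos_at_one[OF R meas[OF u_meas] unit]) (auto simp: truncate_unit_def)
      then show "0 \<le> - ?V (u s) z"
        by simp
    next
      fix s :: real assume "0 \<le> s"
      then show "((\<lambda>t. 1 - u t z) has_real_derivative - ?V (u s) z) (at s within {0..})"
        using DERIV_diff[OF DERIV_const u_deriv[OF _ z]] by simp
    qed (use z u_0 W01 that in auto)
    then show "u t z \<le> 1"
      by simp
  qed
  have V_eq: "?V (u t) z = velocity M k R (u t) z" if "0 \<le> t" "z \<in> space ?\<Omega>" for t z
    using that u_unit by (intro velocity_cong) (auto simp: truncate_unit_id)
  \<comment> \<open>Mean value inequality for r \<mapsto> u r z - r * ?V (u t) z, whose derivative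
    between s and t is at most L * (C * |s - t|) in absolute value. The bound is the same at all z,
    which turns pointwise derivatives into convergence in \<open>Linf_norm\<close>.\<close>
  have quot: "\<bar>(u s z - u t z) / (s - t) - velocity M k R (u t) z\<bar> \<le> L * (C * \<bar>s - t\<bar>)"
    if "0 \<le> s" "0 \<le> t" "s \<noteq> t" and z: "z \<in> space ?\<Omega>" for s t z
  proof -
    let ?h = "\<lambda>r. u r z - r * ?V (u t) z" and ?S = "{min s t..max s t}"
    have "norm (?h s - ?h t) \<le> L * (C * \<bar>s - t\<bar>) * norm (s - t)"
    proof (rule field_differentiable_bound[where S="?S" and f'="\<lambda>r. ?V (u r) z - ?V (u t) z"])
      fix r assume r: "r \<in> ?S"
      then have "0 \<le> r"
        using that by auto
      have "((\<lambda>r. u r z) has_real_derivative ?V (u r) z) (at r within ?S)"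
        by (rule DERIV_subset[OF u_deriv[OF \<open>0 \<le> r\<close> z]]) (use that in auto)
      then show "(?h has_real_derivative ?V (u r) z - ?V (u t) z) (at r within ?S)"
        by (auto intro!: derivative_eq_intros)
      have "\<bar>u r y - u t y\<bar> \<le> C * \<bar>s - t\<bar>" if "y \<in> space ?\<Omega>" for y
      proof -
        have "\<bar>u r y - u t y\<bar> \<le> C * \<bar>r - t\<bar>"
          using \<open>0 \<le> r\<close> \<open>0 \<le> t\<close> that by (rule u_lip)
        also have "\<dots> \<le> C * \<bar>s - t\<bar>"
          using r \<open>0 \<le> C\<close> by (intro mult_left_mono) (auto simp: min_def max_def split: if_splits)
        finally show ?thesis .
      qed
      then have "\<bar>?V (u r) z - ?V (u t) z\<bar> \<le> L * (C * \<bar>s - t\<bar>)"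
        using \<open>0 \<le> r\<close> \<open>0 \<le> t\<close> z by (intro lipschitz_field u_meas)
      then show "norm (?V (u r) z - ?V (u t) z) \<le> L * (C * \<bar>s - t\<bar>)"
        by simp
    qed (use that in auto)
    moreover have "?h s - ?h t = ((u s z - u t z) / (s - t) - ?V (u t) z) * (s - t)"
      using that by (simp add: field_simps)
    ultimately have "\<bar>(u s z - u t z) / (s - t) - ?V (u t) z\<bar> * \<bar>s - t\<bar> \<le> L * (C * \<bar>s - t\<bar>) * \<bar>s - t\<bar>"
      by (simp only: abs_mult real_norm_def)
    then show ?thesis
      using that by (simp only: V_eq[OF \<open>0 \<le> t\<close> z]) (rule mult_right_le_imp_le, assumption, simp)
  qed
  have "is_trajectory M k R W u"
    unfolding is_trajectory_def
  proof (intro conjI allI impI)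
    fix t :: real assume "0 \<le> t"
    have "\<bar>u t z\<bar> \<le> 1" if "z \<in> space ?\<Omega>" for z
      using u_unit[OF \<open>0 \<le> t\<close> that] by linarith
    then show "u t \<in> kernels M"
      using u_meas[OF \<open>0 \<le> t\<close>] u_sym[OF \<open>0 \<le> t\<close>] unfolding kernels_def by blast
  next
    show "AE z in ?\<Omega>. u 0 z = W z"
      using u_0 by auto
  next
    fix t :: real assume "0 \<le> t"
    have upper: "\<forall>\<^sub>F s in at t within {0..}. Linf_norm M (\<lambda>z. (u s z - u t z) / (s - t) - velocity M k R (u t) z)
        \<le> ennreal (L * (C * \<bar>s - t\<bar>))"
      unfolding eventually_at_filter
    proof (intro always_eventually allI impI)
      fix s :: real assume s: "s \<noteq> t" "s \<in> {0..}"
      have [measurable]: "u s \<in> borel_measurable ?\<Omega>" "u t \<in> borel_measurable ?\<Omega>"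
        "velocity M k R (u t) \<in> borel_measurable ?\<Omega>"
        using s \<open>0 \<le> t\<close> by (auto intro: u_meas measurable_velocity)
      have "(\<lambda>z. ennreal \<bar>(u s z - u t z) / (s - t) - velocity M k R (u t) z\<bar>) \<in> borel_measurable ?\<Omega>"
        by measurable
      then show "Linf_norm M (\<lambda>z. (u s z - u t z) / (s - t) - velocity M k R (u t) z)
          \<le> ennreal (L * (C * \<bar>s - t\<bar>))"
        unfolding Linf_norm_def using s \<open>0 \<le> t\<close>
        by (intro esssup_I AE_I2 ennreal_leI quot) auto
    qed
    have "((\<lambda>s. ennreal (L * (C * \<bar>s - t\<bar>))) \<longlongrightarrow> ennreal (L * (C * \<bar>t - t\<bar>))) (at t within {0..})"
      by (intro tendsto_ennrealI tendsto_mult tendsto_const tendsto_rabs tendsto_diff tendsto_ident_at)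
    then have "((\<lambda>s. ennreal (L * (C * \<bar>s - t\<bar>))) \<longlongrightarrow> 0) (at t within {0..})"
      by simp
    from tendsto_sandwich[OF _ upper tendsto_const this]
    show "((\<lambda>s. Linf_norm M (\<lambda>z. (u s z - u t z) / (s - t) - velocity M k R (u t) z))
        \<longlongrightarrow> 0) (at t within {0..})"
      by simp
  qed
  then show ?thesis
    by (intro exI[of _ u]) assumption
qed

section \<open>Class sums, velocities and flows\<close>

lemma velocity_eq_if_class_change_eq:
  assumes eq: "\<forall>J\<in>rooted_classes k. class_change k R\<^sub>1 J = class_change k R\<^sub>2 J"
    and W: "W \<in> kernels M" and z: "z \<in> space (M \<Otimes>\<^sub>M M)"
  shows "velocity M k R\<^sub>1 W z = velocity M k R\<^sub>2 W z"
proof -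
  have split: "velocity M k R W z = (\<Sum>J\<in>rooted_classes k. \<Sum>X\<in>J. root_change k R X * rooted_density M k X W z)" for R
  proof -
    have "\<forall>J\<in>rooted_classes k. finite J"
      using equiv_rooted_iso unfolding rooted_classes_def
      by (metis finite_rooted_graphs finite_subset in_quotient_imp_subset)
    moreover have "\<forall>J\<in>rooted_classes k. \<forall>K\<in>rooted_classes k. J \<noteq> K \<longrightarrow> J \<inter> K = {}"
      unfolding rooted_classes_def using quotient_disj[OF equiv_rooted_iso] by blast
    moreover have "rooted_graphs k = \<Union>(rooted_classes k)"
      unfolding rooted_classes_def by (simp add: Union_quotient[OF equiv_rooted_iso])
    ultimately show ?thesis
      unfolding velocity_def by (simp add: sum.Union_disjoint)
  qed
  have "(\<Sum>X\<in>J. root_change k R X * rooted_density M k X W z) =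
      class_change k R J * rooted_density M k (SOME X. X \<in> J) W z" if J: "J \<in> rooted_classes k" for J R
  proof -
    have "rooted_density M k X W z = rooted_density M k (SOME X. X \<in> J) W z" if "X \<in> J" for X
    proof (rule rooted_density_iso[OF _ W z])
      show "(X, SOME X. X \<in> J) \<in> rooted_iso k"
        using J that someI[of "\<lambda>X. X \<in> J"] quotient_eq_iff[OF equiv_rooted_iso] unfolding rooted_classes_def
        by metis
    qed
    then show ?thesis
      by (simp add: class_change_def sum_distrib_right)
  qed
  then show ?thesis
    unfolding split using eq by simp
qed

lemma flow_eq_if_class_change_eq:
  assumes "\<forall>J\<in>rooted_classes k. class_change k R\<^sub>1 J = class_change k R\<^sub>2 J"
  shows "flow M k R\<^sub>1 W = flow M k R\<^sub>2 W"
proof -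
  have "Linf_norm M (\<lambda>z. (u s z - u t z) / (s - t) - velocity M k R\<^sub>1 (u t) z) =
      Linf_norm M (\<lambda>z. (u s z - u t z) / (s - t) - velocity M k R\<^sub>2 (u t) z)"
    if "u t \<in> kernels M" for u s t
  proof -
    let ?f = "\<lambda>R z. ennreal \<bar>(u s z - u t z) / (s - t) - velocity M k R (u t) z\<bar>"
    have eq: "?f R\<^sub>1 z = ?f R\<^sub>2 z" if "z \<in> space (M \<Otimes>\<^sub>M M)" for z
      using velocity_eq_if_class_change_eq[OF assms \<open>u t \<in> kernels M\<close> that] by simp
    \<comment> \<open>\<open>esssup\<close> is defined by cases on measurability, so both
      measurability and \<open>Limsup\<close> are transferred from one rule to the other.\<close>
    then have "?f R\<^sub>1 \<in> borel_measurable (M \<Otimes>\<^sub>M M) \<longleftrightarrow> ?f R\<^sub>2 \<in> borel_measurable (M \<Otimes>\<^sub>M M)"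
      by (intro measurable_cong)
    moreover have "Limsup (ae_filter (M \<Otimes>\<^sub>M M)) (?f R\<^sub>1) = Limsup (ae_filter (M \<Otimes>\<^sub>M M)) (?f R\<^sub>2)"
      using eq by (intro Limsup_eq AE_I2)
    ultimately show ?thesis
      by (simp only: Linf_norm_def esssup_def)
  qed
  then have "is_trajectory M k R\<^sub>1 W = is_trajectory M k R\<^sub>2 W"
    unfolding is_trajectory_def by (intro ext) auto
  then show ?thesis
    by (simp add: flow_def)
qed

text \<open>The difference quotients of a flow at time 0 converge to the velocity of W almost
  everywhere along the times 1 / (n + 1). Only countably many times are used, so the exceptional
  sets together form a null set.\<close>

lemma velocity_eq_if_flow_eq:
  assumes R: "is_rule k R\<^sub>1" "is_rule k R\<^sub>2" and W: "W \<in> graphons M"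
    and eq: "\<forall>t\<ge>0. AE z in M \<Otimes>\<^sub>M M. flow M k R\<^sub>1 W t z = flow M k R\<^sub>2 W t z"
  shows "AE z in M \<Otimes>\<^sub>M M. velocity M k R\<^sub>1 W z = velocity M k R\<^sub>2 W z"
proof -
  let ?\<Omega> = "M \<Otimes>\<^sub>M M"
  have W_meas: "W \<in> borel_measurable ?\<Omega>"
    using W by (simp add: graphons_def kernels_def)
  define e where "e n = 1 / real (Suc n)" for n
  have e: "0 < e n" for n
    by (simp add: e_def)
  have "e \<longlonglongrightarrow> 0"
    unfolding e_def using LIMSEQ_Suc[OF lim_1_over_n] by simp
  then have e_lim: "filterlim e (at 0 within {0..}) sequentially"
    using e by (auto simp: filterlim_at less_imp_le less_imp_neq[symmetric])
  have derivative: "AE z in ?\<Omega>. (\<lambda>n. (flow M k R W (e n) z - flow M k R W 0 z) / e n) \<longlonglongrightarrow> velocity M k R W z"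
    if R: "is_rule k R" for R
  proof -
    let ?u = "flow M k R W"
    have "is_trajectory M k R W ?u"
      unfolding flow_def by (rule someI_ex[OF trajectory_exists[OF R W]])
    then have u: "?u 0 \<in> kernels M" "AE z in ?\<Omega>. ?u 0 z = W z"
      "((\<lambda>s. Linf_norm M (\<lambda>z. (?u s z - ?u 0 z) / (s - 0) - velocity M k R (?u 0) z)) \<longlongrightarrow> 0) (at 0 within {0..})"
      unfolding is_trajectory_def by auto
    let ?g = "\<lambda>n z. (?u (e n) z - ?u 0 z) / e n - velocity M k R (?u 0) z"
    have lim: "(\<lambda>n. Linf_norm M (?g n)) \<longlonglongrightarrow> 0"
      using filterlim_compose[OF u(3) e_lim] by simp
    have "AE z in ?\<Omega>. \<forall>n. ennreal \<bar>?g n z\<bar> \<le> Linf_norm M (?g n)"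
      unfolding Linf_norm_def by (subst AE_all_countable) (intro allI esssup_AE)
    moreover have "AE z in ?\<Omega>. velocity M k R (?u 0) z = velocity M k R W z"
      using u(1,2) W_meas by (intro AE_velocity_cong) (auto simp: kernels_def)
    ultimately show ?thesis
    proof eventually_elim
      case (elim z)
      have "(\<lambda>n. ennreal \<bar>?g n z\<bar>) \<longlonglongrightarrow> 0"
        using elim(1) by (intro tendsto_sandwich[OF _ _ tendsto_const lim]) auto
      then have "(\<lambda>n. \<bar>?g n z\<bar>) \<longlonglongrightarrow> 0"
        using tendsto_ennrealD[of "\<lambda>n. \<bar>?g n z\<bar>" 0 sequentially] by simp
      then have "(\<lambda>n. (?u (e n) z - ?u 0 z) / e n) \<longlonglongrightarrow> velocity M k R (?u 0) z"
        using tendsto_rabs_zero_iff LIM_zero_cancel by blast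
      then show ?case
        using elim(2) by simp
    qed
  qed
  have "AE z in ?\<Omega>. flow M k R\<^sub>1 W 0 z = flow M k R\<^sub>2 W 0 z"
    using eq by simp
  moreover have "AE z in ?\<Omega>. \<forall>n. flow M k R\<^sub>1 W (e n) z = flow M k R\<^sub>2 W (e n) z"
    using eq e by (subst AE_all_countable) (auto intro: less_imp_le)
  ultimately show ?thesis
    using derivative[OF R(1)] derivative[OF R(2)]
  proof eventually_elim
    case (elim z)
    then show ?case
      using LIMSEQ_unique by simp
  qed
qed

end

section \<open>Step graphons\<close>

text \<open>The graph that the step graphon of G produces when vertex i lies in block
  \<open>\<phi> i\<close>. The map need not be injective: vertices in the same block are not
  adjacent when G is a labelled graph, since G then contains no singleton.\<close>

definition pullback_graph :: "nat \<Rightarrow> (nat \<Rightarrow> nat) \<Rightarrow> nat set set \<Rightarrow> nat set set" where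
  "pullback_graph k \<phi> G = {e \<in> nsets {1..k} 2. \<phi> ` e \<in> G}"

lemma labelled_graphs_singleton: "G \<in> labelled_graphs k \<Longrightarrow> {u} \<notin> G"
  by (auto simp: labelled_graphs_def nsets_def)

lemma eq_pullback_graph_iff:
  assumes F: "F \<in> labelled_graphs k" and G: "G \<in> labelled_graphs k"
  shows "F = pullback_graph k \<phi> G \<longleftrightarrow> (\<forall>u\<in>{1..k}. \<forall>v\<in>{1..k}. {u, v} \<in> F \<longleftrightarrow> {\<phi> u, \<phi> v} \<in> G)"
proof
  assume eq: "F = pullback_graph k \<phi> G"
  have "{u, v} \<in> F \<longleftrightarrow> {\<phi> u, \<phi> v} \<in> G" if "u \<in> {1..k}" "v \<in> {1..k}" for u v
  proof (cases "u = v")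
    case True
    then show ?thesis
      using labelled_graphs_singleton[OF F] labelled_graphs_singleton[OF G] by simp
  next
    case False
    then show ?thesis
      using that by (simp add: eq pullback_graph_def)
  qed
  then show "\<forall>u\<in>{1..k}. \<forall>v\<in>{1..k}. {u, v} \<in> F \<longleftrightarrow> {\<phi> u, \<phi> v} \<in> G"
    by blast
next
  assume iso: "\<forall>u\<in>{1..k}. \<forall>v\<in>{1..k}. {u, v} \<in> F \<longleftrightarrow> {\<phi> u, \<phi> v} \<in> G"
  have "e \<in> F \<longleftrightarrow> \<phi> ` e \<in> G" if "e \<in> nsets {1..k} 2" for e
    using iso that by (elim nsets2_E) simp
  then show "F = pullback_graph k \<phi> G"
    using F by (auto simp: pullback_graph_def labelled_graphs_def)
qed

lemma pullback_graph_cong: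
  assumes "\<And>i. i \<in> {1..k} \<Longrightarrow> \<phi> i = \<psi> i"
  shows "pullback_graph k \<phi> G = pullback_graph k \<psi> G"
proof -
  have "\<phi> ` e = \<psi> ` e" if "e \<in> nsets {1..k} 2" for e
    using assms that by (intro image_cong) (auto simp: nsets_def)
  then show ?thesis
    by (auto simp: pullback_graph_def)
qed

lemma prod_of_bool:
  "finite A \<Longrightarrow> (\<Prod>x\<in>A. of_bool (P x)) = (of_bool (\<forall>x\<in>A. P x) :: 'b :: comm_semiring_1)"
  by (induction A rule: finite_induct) auto

definition step_graphon :: "('a \<Rightarrow> nat) \<Rightarrow> nat set set \<Rightarrow> 'a \<times> 'a \<Rightarrow> real" where
  "step_graphon f G = (\<lambda>(x, y). of_bool ({f x, f y} \<in> G))"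

text \<open>Every factor is 0 or 1, and is 1 exactly when F and the graph read off from the blocks
  of v agree on that pair.\<close>

lemma edge_product_step_graphon:
  assumes F: "F \<in> labelled_graphs k" and G: "G \<in> labelled_graphs k"
  shows "edge_product k F (step_graphon f G) v = of_bool (F = pullback_graph k (f \<circ> v) G)"
proof -
  have "edge_product k F (step_graphon f G) v =
      (\<Prod>e\<in>vertex_pairs k. of_bool ({fst e, snd e} \<in> F \<longleftrightarrow> {f (v (fst e)), f (v (snd e))} \<in> G))"
    unfolding edge_product_def step_graphon_def by (intro prod.cong) auto
  also have "\<dots> = of_bool (\<forall>e\<in>vertex_pairs k. {fst e, snd e} \<in> F \<longleftrightarrow> {f (v (fst e)), f (v (snd e))} \<in> G)"
    by (rule prod_of_bool) simp
  also have "(\<forall>e\<in>vertex_pairs k. {fst e, snd e} \<in> F \<longleftrightarrow> {f (v (fst e)), f (v (snd e))} \<in> G) \<longleftrightarrow>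
      F = pullback_graph k (f \<circ> v) G"
    unfolding eq_pullback_graph_iff[OF F G]
  proof (rule iffI, intro ballI)
    fix i j assume *: "\<forall>e\<in>vertex_pairs k. {fst e, snd e} \<in> F \<longleftrightarrow> {f (v (fst e)), f (v (snd e))} \<in> G"
      and ij: "i \<in> {1..k}" "j \<in> {1..k}"
    consider "i = j" | "i < j" | "j < i"
      by linarith
    then show "{i, j} \<in> F \<longleftrightarrow> {(f \<circ> v) i, (f \<circ> v) j} \<in> G"
    proof cases
      case 1
      then show ?thesis
        using labelled_graphs_singleton[OF F] labelled_graphs_singleton[OF G] by simp
    next
      case 2
      then show ?thesis
        using bspec[OF *, of "(i, j)"] ij by (simp add: vertex_pairs_def)
    next
      case 3
      then show ?thesis
        using bspec[OF *, of "(j, i)"] ij by (simp add: vertex_pairs_def insert_commute)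
    qed
  qed (auto simp: vertex_pairs_def)
  finally show ?thesis .
qed

context prob_space
begin

lemma step_graphon_in_graphons:
  assumes f: "f \<in> space M \<rightarrow> {1..k}" and blocks: "\<And>i. i \<in> {1..k} \<Longrightarrow> {x \<in> space M. f x = i} \<in> sets M"
  shows "step_graphon f G \<in> graphons M"
proof -
  let ?A = "\<lambda>i. {x \<in> space M. f x = i}"
  \<comment> \<open>\<open>f\<close> is controlled only through its blocks, so the step graphon is
    written as a finite combination of indicators of products of blocks.\<close>
  have eq: "step_graphon f G z = (\<Sum>i\<in>{1..k}. \<Sum>j\<in>{1..k}. of_bool ({i, j} \<in> G) *
      (indicator (?A i) (fst z) * indicator (?A j) (snd z)))" if "z \<in> space (M \<Otimes>\<^sub>M M)" for z
  proof -
    obtain x y where z: "z = (x, y)"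
      by (metis prod.exhaust)
    have xy: "x \<in> space M" "y \<in> space M"
      using that by (auto simp: z space_pair_measure)
    have "(\<Sum>i\<in>{1..k}. \<Sum>j\<in>{1..k}. of_bool ({i, j} \<in> G) *
        (indicator (?A i) x * indicator (?A j) y)) =
        (\<Sum>i\<in>{1..k}. \<Sum>j\<in>{1..k}. if j = f y then if i = f x then of_bool ({i, j} \<in> G) else 0 else 0 :: real)"
      using xy by (intro sum.cong) (auto simp: indicator_def)
    also have "\<dots> = of_bool ({f x, f y} \<in> G)"
      using funcset_mem[OF f xy(1)] funcset_mem[OF f xy(2)] by (simp add: sum.delta)
    finally show ?thesis
      by (simp add: z step_graphon_def)
  qed
  have "(\<lambda>z. \<Sum>i\<in>{1..k}. \<Sum>j\<in>{1..k}. of_bool ({i, j} \<in> G) *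
      (indicator (?A i) (fst z) * indicator (?A j) (snd z)) :: real) \<in> borel_measurable (M \<Otimes>\<^sub>M M)"
    by (intro borel_measurable_sum borel_measurable_times borel_measurable_const
        measurable_compose[OF measurable_fst] measurable_compose[OF measurable_snd]
        borel_measurable_indicator blocks)
  moreover have "step_graphon f G \<in> borel_measurable (M \<Otimes>\<^sub>M M) \<longleftrightarrow>
      (\<lambda>z. \<Sum>i\<in>{1..k}. \<Sum>j\<in>{1..k}. of_bool ({i, j} \<in> G) *
        (indicator (?A i) (fst z) * indicator (?A j) (snd z)) :: real) \<in> borel_measurable (M \<Otimes>\<^sub>M M)"
    by (rule measurable_cong) (rule eq)
  ultimately have "step_graphon f G \<in> borel_measurable (M \<Otimes>\<^sub>M M)"
    by (simp only:)
  moreover have "\<bar>step_graphon f G z\<bar> \<le> 1" "0 \<le> step_graphon f G z" "step_graphon f G z \<le> 1" for z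
    by (auto simp: step_graphon_def split: prod.splits)
  moreover have "step_graphon f G (x, y) = step_graphon f G (y, x)" for x y
    by (simp add: step_graphon_def insert_commute)
  ultimately show ?thesis
    unfolding graphons_def kernels_def by blast
qed

text \<open>Conditioning on the blocks \<psi> of the vertices other than the roots: given \<psi> the
  integrand is constant, and by independence the probability of \<psi> is a product.\<close>

lemma rooted_density_step_graphon:
  assumes f: "f \<in> space M \<rightarrow> {1..k}" and blocks: "\<And>i. i \<in> {1..k} \<Longrightarrow> {x \<in> space M. f x = i} \<in> sets M"
    and X: "(F, a, b) \<in> rooted_graphs k" and G: "G \<in> labelled_graphs k"
    and xy: "x \<in> space M" "y \<in> space M"
  shows "rooted_density M k (F, a, b) (step_graphon f G) (x, y) =
    (\<Sum>\<psi>\<in>({1..k} - {a, b}) \<rightarrow>\<^sub>E {1..k}. of_bool (F = pullback_graph k (\<psi>(a := f x, b := f y)) G) *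
       (\<Prod>i\<in>{1..k} - {a, b}. prob {x \<in> space M. f x = \<psi> i}))"
proof -
  let ?I = "{1..k} - {a, b}"
  let ?E = "?I \<rightarrow>\<^sub>E {1..k}" and ?A = "\<lambda>i. {x \<in> space M. f x = i}"
  let ?P = "PiM ?I (\<lambda>_. M)"
  let ?c = "\<lambda>\<psi>. of_bool (F = pullback_graph k (\<psi>(a := f x, b := f y)) G) :: real"
  interpret product_sigma_finite "\<lambda>_. M" ..
  have F: "F \<in> labelled_graphs k"
    using X by (auto dest: rooted_graphsD)
  have finE: "finite ?E"
    by (rule finite_PiE) simp_all
  have A: "?A (\<psi> j) \<in> sets M" if "\<psi> \<in> ?E" "j \<in> ?I" for \<psi> j
    by (rule blocks) (rule PiE_mem[OF that])
  have ind: "edge_product k F (step_graphon f G) (p(a := x, b := y)) =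
      (\<Sum>\<psi>\<in>?E. ?c \<psi> * (\<Prod>i\<in>?I. indicator (?A (\<psi> i)) (p i)))" if p: "p \<in> space ?P" for p
  proof -
    have p_mem: "p i \<in> space M" if "i \<in> ?I" for i
      using PiE_mem[of p ?I "\<lambda>_. space M" i] p that by (simp add: space_PiM)
    \<comment> \<open>The blocks hit by the sample p; among all \<psi> only this one has a nonzero
      product of indicators.\<close>
    define \<psi>0 where "\<psi>0 = restrict (f \<circ> p) ?I"
    have \<psi>0: "\<psi>0 \<in> ?E"
      using funcset_mem[OF f p_mem] by (simp only: \<psi>0_def restrict_PiE_iff comp_apply) blast
    have "(\<Prod>i\<in>?I. indicator (?A (\<psi> i)) (p i)) = (of_bool (\<psi> = \<psi>0) :: real)" if "\<psi> \<in> ?E" for \<psi>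
    proof -
      have "(\<Prod>i\<in>?I. indicator (?A (\<psi> i)) (p i)) = (\<Prod>i\<in>?I. of_bool (f (p i) = \<psi> i) :: real)"
        using p_mem by (intro prod.cong) (auto simp: indicator_def)
      also have "\<dots> = of_bool (\<forall>i\<in>?I. f (p i) = \<psi> i)"
        by (rule prod_of_bool) simp
      also have "(\<forall>i\<in>?I. f (p i) = \<psi> i) \<longleftrightarrow> \<psi> = \<psi>0"
        using PiE_ext[OF that \<psi>0] by (metis \<psi>0_def comp_apply restrict_apply')
      finally show ?thesis .
    qed
    then have "(\<Sum>\<psi>\<in>?E. ?c \<psi> * (\<Prod>i\<in>?I. indicator (?A (\<psi> i)) (p i))) =
        (\<Sum>\<psi>\<in>?E. if \<psi> = \<psi>0 then ?c \<psi>0 else 0)"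
      by (intro sum.cong) auto
    also have "\<dots> = ?c \<psi>0"
      using \<psi>0 finE by (simp add: sum.delta)
    also have "pullback_graph k (\<psi>0(a := f x, b := f y)) G = pullback_graph k (f \<circ> (p(a := x, b := y))) G"
      by (rule pullback_graph_cong) (auto simp: \<psi>0_def)
    also have "of_bool (F = \<dots>) = edge_product k F (step_graphon f G) (p(a := x, b := y))"
      by (rule edge_product_step_graphon[OF F G, symmetric])
    finally show ?thesis ..
  qed
  have int: "integrable ?P (\<lambda>p. \<Prod>i\<in>?I. indicator (?A (\<psi> i)) (p i) :: real)" if "\<psi> \<in> ?E" for \<psi>
    by (rule product_integrable_prod[of ?I "\<lambda>i z. indicator (?A (\<psi> i)) z"])
      (use A[OF that] in \<open>simp_all add: integrable_indicator_iff less_top[symmetric]\<close>)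
  have "rooted_density M k (F, a, b) (step_graphon f G) (x, y) =
      (\<integral>p. (\<Sum>\<psi>\<in>?E. ?c \<psi> * (\<Prod>i\<in>?I. indicator (?A (\<psi> i)) (p i))) \<partial>?P)"
    unfolding rooted_density_eq by (rule Bochner_Integration.integral_cong[OF refl ind])
  also have "\<dots> = (\<Sum>\<psi>\<in>?E. ?c \<psi> * (\<integral>p. (\<Prod>i\<in>?I. indicator (?A (\<psi> i)) (p i)) \<partial>?P))"
    using int by (subst Bochner_Integration.integral_sum) auto
  also have "\<dots> = (\<Sum>\<psi>\<in>?E. ?c \<psi> * (\<Prod>i\<in>?I. prob (?A (\<psi> i))))"
  proof (intro sum.cong refl arg_cong2[where f=times])
    fix \<psi> assume \<psi>: "\<psi> \<in> ?E"
    have "(\<integral>p. (\<Prod>i\<in>?I. indicator (?A (\<psi> i)) (p i)) \<partial>?P) =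
        (\<Prod>i\<in>?I. \<integral>z. indicator (?A (\<psi> i)) z \<partial>M :: real)"
      by (rule product_integral_prod[of ?I "\<lambda>i z. indicator (?A (\<psi> i)) z"])
        (use A[OF \<psi>] in \<open>simp_all add: integrable_indicator_iff less_top[symmetric]\<close>)
    also have "\<dots> = (\<Prod>i\<in>?I. prob (?A (\<psi> i)))"
      using A[OF \<psi>] by (intro prod.cong) (auto simp: Int_absorb1)
    finally show "(\<integral>p. (\<Prod>i\<in>?I. indicator (?A (\<psi> i)) (p i)) \<partial>?P) = (\<Prod>i\<in>?I. prob (?A (\<psi> i)))" .
  qed
  finally show ?thesis .
qed

text \<open>The product of A and B has positive measure, so it is not contained in the exceptional
  null set. This turns equality of velocities almost everywhere into an exact equation at a point
  with the roots in prescribed blocks.\<close>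

lemma AE_pair_obtains_point:
  assumes AE: "AE z in M \<Otimes>\<^sub>M M. P z" and A: "A \<in> sets M" "0 < prob A" and B: "B \<in> sets M" "0 < prob B"
  obtains x y where "x \<in> A" "y \<in> B" "P (x, y)"
proof -
  have "\<exists>x\<in>A. \<exists>y\<in>B. P (x, y)"
  proof (rule ccontr)
    assume "\<not> (\<exists>x\<in>A. \<exists>y\<in>B. P (x, y))"
    then have "AE z in M \<Otimes>\<^sub>M M. z \<notin> A \<times> B"
      using AE by (elim eventually_mono) auto
    then have "A \<times> B \<in> null_sets (M \<Otimes>\<^sub>M M)"
      using A B by (subst AE_iff_null_sets) auto
    then have "emeasure M A * emeasure M B = 0"
      using emeasure_pair_measure_Times[OF A(1) B(1)] by (simp add: null_sets_def)
    then show False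
      using A B by (simp add: emeasure_eq_measure)
  qed
  then show thesis
    using that by blast
qed

end

text \<open>The alternating sum extracts the coefficient of \<open>\<Prod>j\<in>B. c j\<close> from a homogeneous polynomial of
  degree \<open>card B\<close> using only positive weights \<open>c j \<in> {1, 2}\<close>.\<close>

lemma alternating_sum_subsets:
  fixes \<psi> :: "'b \<Rightarrow> 'c"
  assumes I: "finite I" and B: "finite B" and card: "card I = card B"
  shows "(\<Sum>S\<in>Pow B. (-1) ^ card S * (\<Prod>i\<in>I. 1 + of_bool (\<psi> i \<in> S))) =
    ((-1) ^ card B * of_bool (bij_betw \<psi> I B) :: real)"
proof -
  let ?m = "\<lambda>j. card {i \<in> I. \<psi> i = j}"
  have "(\<Prod>i\<in>I. 1 + of_bool (\<psi> i \<in> S)) = (\<Prod>j\<in>S. 2 ^ ?m j :: real)" if "S \<in> Pow B" for S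
  proof -
    have S: "finite S"
      using that B finite_subset by auto
    have "(\<Prod>i\<in>I. 1 + of_bool (\<psi> i \<in> S) :: real) = (\<Prod>i\<in>I. if \<psi> i \<in> S then 2 else 1)"
      by (intro prod.cong) auto
    also have "\<dots> = (\<Prod>i\<in>{i \<in> I. \<psi> i \<in> S}. 2)"
      by (rule prod.inter_filter[OF I, symmetric])
    also have "\<dots> = (\<Prod>j\<in>S. \<Prod>i\<in>{i \<in> {i \<in> I. \<psi> i \<in> S}. \<psi> i = j}. 2)"
      using I S by (subst prod.group) auto
    also have "\<dots> = (\<Prod>j\<in>S. 2 ^ ?m j)"
    proof (rule prod.cong)
      fix j assume "j \<in> S"
      then have "{i \<in> {i \<in> I. \<psi> i \<in> S}. \<psi> i = j} = {i \<in> I. \<psi> i = j}"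
        by auto
      then show "(\<Prod>i\<in>{i \<in> {i \<in> I. \<psi> i \<in> S}. \<psi> i = j}. 2) = (2 ^ ?m j :: real)"
        by simp
    qed simp
    finally show ?thesis .
  qed
  then have "(\<Sum>S\<in>Pow B. (-1) ^ card S * (\<Prod>i\<in>I. 1 + of_bool (\<psi> i \<in> S)) :: real) =
      (\<Sum>S\<in>Pow B. (\<Prod>j\<in>S. - (2 ^ ?m j)) * (\<Prod>j\<in>B - S. 1))"
    by (intro sum.cong) (auto simp: prod_uminus)
  \<comment> \<open>Read backwards, the expansion of a product of two-term factors: the power of 2
    is chosen for j in S and 1 for the other j.\<close>
  also have "\<dots> = (\<Prod>j\<in>B. - (2 ^ ?m j) + 1)"
    by (rule prod_add[OF B, symmetric])
  \<comment> \<open>A factor vanishes exactly when no element of I is sent to j. If none vanishes,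
    \<psi> covers B, and equal cardinalities force one preimage for each j, so every factor is 1 - 2
    = -1.\<close>
  also have "\<dots> = (-1) ^ card B * of_bool (bij_betw \<psi> I B)"
  proof (cases "B \<subseteq> \<psi> ` I")
    case True
    have "card (\<psi> ` I) \<le> card B"
      using card_image_le[OF I, of \<psi>] card by simp
    then have im: "\<psi> ` I = B"
      using card_seteq[OF finite_imageI[OF I] True] by simp
    then have inj: "inj_on \<psi> I"
      using I card by (intro eq_card_imp_inj_on) auto
    have "?m j = 1" if "j \<in> B" for j
    proof -
      have "j \<in> \<psi> ` I"
        using that im by simp
      then obtain i where "i \<in> I" "\<psi> i = j"
        by blast
      then have "{i \<in> I. \<psi> i = j} = {i}"
        using inj by (auto simp: inj_on_def)
      then show ?thesis
        by simp
    qed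
    then have "(\<Prod>j\<in>B. - (2 ^ ?m j) + 1) = (\<Prod>j\<in>B. - 1 :: real)"
      by (intro prod.cong) auto
    then show ?thesis
      using inj im by (simp add: bij_betw_def)
  next
    case False
    then obtain j where j: "j \<in> B" "j \<notin> \<psi> ` I"
      by auto
    then have "{i \<in> I. \<psi> i = j} = {}"
      by auto
    then have "?m j = 0"
      by (simp only: card.empty)
    then have "(\<Prod>j\<in>B. - (2 ^ ?m j) + 1) = (0 :: real)"
      using j by (intro prod_zero B bexI[of _ j]) auto
    moreover have "\<not> bij_betw \<psi> I B"
      using j by (auto simp: bij_betw_def)
    ultimately show ?thesis
      by simp
  qed
  finally show ?thesis .
qed

section \<open>Isolating an isomorphism class\<close>

text \<open>Taking extensional maps makes the set finite and counts each isomorphism once.\<close>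

definition rooted_isos :: "nat \<Rightarrow> nat set set \<times> nat \<times> nat \<Rightarrow> nat set set \<times> nat \<times> nat \<Rightarrow> (nat \<Rightarrow> nat) set" where
  "rooted_isos k = (\<lambda>(F, a, b) (G, c, d). {\<phi> \<in> extensional {1..k}. bij_betw \<phi> {1..k} {1..k} \<and>
     (\<forall>u\<in>{1..k}. \<forall>v\<in>{1..k}. {u, v} \<in> F \<longleftrightarrow> {\<phi> u, \<phi> v} \<in> G) \<and> \<phi> a = c \<and> \<phi> b = d})"

lemma finite_rooted_isos: "finite (rooted_isos k X Y)"
proof (rule finite_subset)
  show "rooted_isos k X Y \<subseteq> {1..k} \<rightarrow>\<^sub>E {1..k}"
    by (auto simp: rooted_isos_def PiE_def dest: bij_betw_imp_funcset split: prod.splits)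
  show "finite ({1..k} \<rightarrow>\<^sub>E {1..k})"
    by (rule finite_PiE) simp_all
qed

lemma rooted_isos_self: "X \<in> rooted_graphs k \<Longrightarrow> restrict id {1..k} \<in> rooted_isos k X X"
  by (auto simp: rooted_isos_def rooted_graphs_def bij_betw_restrict_eq)

lemma rooted_iso_if_rooted_isos:
  assumes "X \<in> rooted_graphs k" "Y \<in> rooted_graphs k" "\<phi> \<in> rooted_isos k X Y"
  shows "(X, Y) \<in> rooted_iso k"
  using assms by (auto simp: rooted_iso_def rooted_isos_def split: prod.splits)

text \<open>Composition with a fixed isomorphism \<theta> from Y to X is injective because \<theta>
  is onto.\<close>

lemma card_rooted_isos_le:
  assumes "(Y, X) \<in> rooted_iso k"
  shows "card (rooted_isos k X Z) \<le> card (rooted_isos k Y Z)"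
proof -
  obtain F a b G c d H e f where [simp]: "Y = (F, a, b)" "X = (G, c, d)" "Z = (H, e, f)"
    by (metis prod.exhaust)
  obtain \<theta> where rg: "(F, a, b) \<in> rooted_graphs k"
    and \<theta>: "bij_betw \<theta> {1..k} {1..k}" "\<And>u v. u \<in> {1..k} \<Longrightarrow> v \<in> {1..k} \<Longrightarrow> {u, v} \<in> F \<longleftrightarrow> {\<theta> u, \<theta> v} \<in> G"
      "\<theta> a = c" "\<theta> b = d"
    using assms by (auto simp: rooted_iso_def)
  let ?h = "\<lambda>\<phi>. restrict (\<phi> \<circ> \<theta>) {1..k}"
  have ab: "a \<in> {1..k}" "b \<in> {1..k}"
    using rg by (auto dest: rooted_graphsD)
  have "?h \<phi> \<in> rooted_isos k Y Z" if "\<phi> \<in> rooted_isos k X Z" for \<phi>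
  proof -
    have \<phi>: "bij_betw \<phi> {1..k} {1..k}" "\<And>u v. u \<in> {1..k} \<Longrightarrow> v \<in> {1..k} \<Longrightarrow> {u, v} \<in> G \<longleftrightarrow> {\<phi> u, \<phi> v} \<in> H"
      "\<phi> c = e" "\<phi> d = f"
      using that by (auto simp: rooted_isos_def)
    have "bij_betw (?h \<phi>) {1..k} {1..k}"
      using bij_betw_trans[OF \<theta>(1) \<phi>(1)] by (simp only: bij_betw_restrict_eq)
    moreover have "{u, v} \<in> F \<longleftrightarrow> {(?h \<phi>) u, (?h \<phi>) v} \<in> H" if "u \<in> {1..k}" "v \<in> {1..k}" for u v
      using \<theta>(2)[OF that] \<phi>(2)[of "\<theta> u" "\<theta> v"] bij_betwE[OF \<theta>(1)] that by simp
    moreover have "(?h \<phi>) a = e" "(?h \<phi>) b = f"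
      using \<theta>(3,4) \<phi>(3,4) ab by auto
    ultimately show ?thesis
      by (simp add: rooted_isos_def)
  qed
  moreover have "inj_on ?h (rooted_isos k X Z)"
  proof (rule inj_onI)
    fix \<phi> \<psi> assume *: "\<phi> \<in> rooted_isos k X Z" "\<psi> \<in> rooted_isos k X Z" and eq: "?h \<phi> = ?h \<psi>"
    have "\<phi> j = \<psi> j" if "j \<in> {1..k}" for j
    proof -
      have "j \<in> \<theta> ` {1..k}"
        using that bij_betw_imp_surj_on[OF \<theta>(1)] by simp
      then obtain i where "i \<in> {1..k}" "j = \<theta> i"
        by blast
      then show ?thesis
        using fun_cong[OF eq, of i] by simp
    qed
    moreover have "\<phi> \<in> extensional {1..k}" "\<psi> \<in> extensional {1..k}"
      using * by (auto simp: rooted_isos_def)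
    ultimately show "\<phi> = \<psi>"
      by (intro extensionalityI)
  qed
  ultimately show ?thesis
    by (intro card_inj_on_le[of ?h] finite_rooted_isos) auto
qed

lemma card_rooted_isos_cong:
  assumes "(X, Y) \<in> rooted_iso k"
  shows "card (rooted_isos k X Z) = card (rooted_isos k Y Z)"
proof (rule antisym)
  have "sym (rooted_iso k)"
    using equiv_rooted_iso[of k] by (rule equivE)
  then have "(Y, X) \<in> rooted_iso k"
    using assms by (rule symD)
  then show "card (rooted_isos k X Z) \<le> card (rooted_isos k Y Z)"
    by (rule card_rooted_isos_le)
  show "card (rooted_isos k Y Z) \<le> card (rooted_isos k X Z)"
    by (rule card_rooted_isos_le[OF assms])
qed

text \<open>An isomorphism that respects the roots is determined by its restriction \<psi> to the
  other vertices, and \<psi> is completed by the prescribed images of the roots. The left side is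
  the count that the alternating sum leaves over.\<close>

lemma card_root_fixing_bijections:
  assumes X: "(F, a, b) \<in> rooted_graphs k" and Y: "(G, c, d) \<in> rooted_graphs k"
  shows "card {\<psi> \<in> ({1..k} - {a, b}) \<rightarrow>\<^sub>E {1..k}.
      F = pullback_graph k (\<psi>(a := c, b := d)) G \<and> bij_betw \<psi> ({1..k} - {a, b}) ({1..k} - {c, d})} =
    card (rooted_isos k (F, a, b) (G, c, d))" (is "card ?L = card ?R")
proof -
  let ?I = "{1..k} - {a, b}" and ?K = "{1..k} - {c, d}"
  have ab: "F \<in> labelled_graphs k" "a \<in> {1..k}" "b \<in> {1..k}" "a \<noteq> b"
    and cd: "G \<in> labelled_graphs k" "c \<in> {1..k}" "d \<in> {1..k}" "c \<noteq> d"
    using X Y by (auto dest: rooted_graphsD)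
  have "bij_betw (\<lambda>\<psi>. \<psi>(a := c, b := d)) ?L ?R"
  proof (rule bij_betwI[where g="\<lambda>\<phi>. restrict \<phi> ?I"])
    show "(\<lambda>\<psi>. \<psi>(a := c, b := d)) \<in> ?L \<rightarrow> ?R"
    proof (rule Pi_I)
      fix \<psi> assume \<psi>: "\<psi> \<in> ?L"
      let ?\<phi> = "\<psi>(a := c, b := d)"
      have "bij_betw ?\<phi> ?I ?K"
        using \<psi> by (subst bij_betw_cong[of _ _ \<psi>]) auto
      then have "bij_betw ?\<phi> (?I \<union> {a}) (?K \<union> {?\<phi> a})"
        by (rule notIn_Un_bij_betw[rotated 2]) (use ab(4) in auto)
      then have "bij_betw ?\<phi> (?I \<union> {a} \<union> {b}) (?K \<union> {?\<phi> a} \<union> {?\<phi> b})"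
        by (rule notIn_Un_bij_betw[rotated 2]) (use ab(4) cd(4) in auto)
      moreover have "?I \<union> {a} \<union> {b} = {1..k}" "?K \<union> {?\<phi> a} \<union> {?\<phi> b} = {1..k}"
        using ab cd by auto
      ultimately have "bij_betw ?\<phi> {1..k} {1..k}"
        by (simp only:)
      moreover have "?\<phi> i = undefined" if "i \<notin> {1..k}" for i
      proof -
        have "i \<notin> ?I" "i \<noteq> a" "i \<noteq> b"
          using that ab(2,3) by blast+
        then show ?thesis
          using PiE_arb[of \<psi> ?I "\<lambda>_. {1..k}" i] \<psi> by simp
      qed
      then have "?\<phi> \<in> extensional {1..k}"
        unfolding extensional_def by blast
      moreover have "\<forall>u\<in>{1..k}. \<forall>v\<in>{1..k}. {u, v} \<in> F \<longleftrightarrow> {?\<phi> u, ?\<phi> v} \<in> G"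
        using \<psi> by (subst eq_pullback_graph_iff[OF ab(1) cd(1), symmetric]) auto
      ultimately show "?\<phi> \<in> ?R"
        using ab(4) by (simp add: rooted_isos_def)
    qed
    show "(\<lambda>\<phi>. restrict \<phi> ?I) \<in> ?R \<rightarrow> ?L"
    proof (rule Pi_I)
      fix \<phi> assume "\<phi> \<in> ?R"
      then have \<phi>: "bij_betw \<phi> {1..k} {1..k}" "\<phi> a = c" "\<phi> b = d"
        "\<forall>u\<in>{1..k}. \<forall>v\<in>{1..k}. {u, v} \<in> F \<longleftrightarrow> {\<phi> u, \<phi> v} \<in> G"
        by (simp_all add: rooted_isos_def)
      have "bij_betw \<phi> {a, b} {c, d}"
        using ab \<phi>(2,3) by (intro bij_betw_subset[OF \<phi>(1)]) auto
      then have "bij_betw \<phi> ?I ?K"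
        using ab cd by (intro bij_betw_DiffI[OF \<phi>(1)]) auto
      then have bij: "bij_betw (restrict \<phi> ?I) ?I ?K"
        by (simp only: bij_betw_restrict_eq)
      have "F = pullback_graph k \<phi> G"
        using \<phi>(4) by (simp only: eq_pullback_graph_iff[OF ab(1) cd(1)])
      also have "\<dots> = pullback_graph k ((restrict \<phi> ?I)(a := c, b := d)) G"
        using \<phi>(2,3) by (intro pullback_graph_cong) auto
      finally have "F = \<dots>" .
      moreover have "restrict \<phi> ?I \<in> ?I \<rightarrow>\<^sub>E {1..k}"
        unfolding restrict_PiE_iff using bij_betwE[OF \<phi>(1)] by blast
      ultimately show "restrict \<phi> ?I \<in> ?L"
        using bij by simp
    qed
    fix \<psi> assume "\<psi> \<in> ?L"
    then have "\<psi> \<in> extensional ?I"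
      by (auto simp: PiE_def)
    then show "restrict (\<psi>(a := c, b := d)) ?I = \<psi>"
      by (intro extensionalityI[of _ ?I]) auto
  next
    fix \<phi> assume "\<phi> \<in> ?R"
    then have "\<phi> \<in> extensional {1..k}" "\<phi> a = c" "\<phi> b = d"
      by (auto simp: rooted_isos_def)
    then show "(restrict \<phi> ?I)(a := c, b := d) = \<phi>"
      using ab by (intro ext) (auto simp: extensional_def)
  qed
  then show ?thesis
    by (rule bij_betw_same_card)
qed

section \<open>Recovering the class sums from the velocity\<close>

context prob_space
begin

lemma class_change_eq_if_velocity_eq:
  assumes atomless: "atomless M" and J: "J \<in> rooted_classes k"
    and eq: "\<And>W. W \<in> graphons M \<Longrightarrow> AE z in M \<Otimes>\<^sub>M M. velocity M k R\<^sub>1 W z = velocity M k R\<^sub>2 W z"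
  shows "class_change k R\<^sub>1 J = class_change k R\<^sub>2 J"
proof -
  obtain X0 where X0: "X0 \<in> rooted_graphs k" "J = rooted_iso k `` {X0}"
    using J by (auto simp: rooted_classes_def elim: quotientE)
  obtain G a0 b0 where X0_eq: "X0 = (G, a0, b0)"
    by (metis prod.exhaust)
  have G: "G \<in> labelled_graphs k" and ab0: "a0 \<in> {1..k}" "b0 \<in> {1..k}" "a0 \<noteq> b0"
    using X0(1) by (auto simp: X0_eq dest: rooted_graphsD)
  define B where "B = {1..k} - {a0, b0}"
  define D where "D X = root_change k R\<^sub>1 X - root_change k R\<^sub>2 X" for X
  define E where "E a b = ({1..k} - {a, b}) \<rightarrow>\<^sub>E {1..k}" for a b
  \<comment> \<open>The polynomial in the block weights that gives the density of (F, a, b) at a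
    point with its roots in blocks a0 and b0; \<psi> assigns blocks to the other vertices.\<close>
  define Q where "Q c = (\<lambda>(F, a, b). \<Sum>\<psi>\<in>E a b. of_bool (F = pullback_graph k (\<psi>(a := a0, b := b0)) G) *
    (\<Prod>i\<in>{1..k} - {a, b}. c (\<psi> i)))" for c :: "nat \<Rightarrow> real"
  define m where "m S i = 1 + (of_bool (i \<in> S) :: real)" for S :: "nat set" and i :: nat
  have card_diff: "card ({1..k} - {a, b}) = k - 2" if "a \<in> {1..k}" "b \<in> {1..k}" "a \<noteq> b" for a b
    using that by (subst card_Diff_subset) auto
  have vanish: "(\<Sum>X\<in>rooted_graphs k. D X * Q (m S) X) = 0" for S
  proof -
    \<comment> \<open>Block measures sum to 1, so the weights are divided by N. All monomials have
      degree k - 2, so every density acquires the same factor 1 / N ^ (k - 2), which can be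
      cancelled.\<close>
    define N where "N = (\<Sum>i\<in>{1..k}. m S i)"
    have m_pos: "0 < m S i" for i
      by (simp add: m_def)
    have "0 < N"
      unfolding N_def using ab0 by (intro sum_pos m_pos) auto
    have "(\<Sum>i\<in>{1..k}. m S i / N) = prob (space M)"
      using \<open>0 < N\<close> by (simp add: N_def prob_space flip: sum_divide_distrib)
    then obtain f where f: "f \<in> space M \<rightarrow> {1..k}"
      and blocks: "\<And>i. i \<in> {1..k} \<Longrightarrow> {x \<in> space M. f x = i} \<in> sets M"
      and prob: "\<And>i. i \<in> {1..k} \<Longrightarrow> prob {x \<in> space M. f x = i} = m S i / N"
      using atomless_block_map[OF atomless, of "{1..k}" "\<lambda>i. m S i / N" "space M"] ab0 m_pos \<open>0 < N\<close>
      by (auto simp: less_imp_le)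
    have "AE z in M \<Otimes>\<^sub>M M. velocity M k R\<^sub>1 (step_graphon f G) z = velocity M k R\<^sub>2 (step_graphon f G) z"
      by (intro eq step_graphon_in_graphons[OF f blocks])
    \<comment> \<open>All weights are positive, so both root blocks have positive measure and the
      velocities agree at some point over them.\<close>
    then obtain x y where x: "x \<in> space M" "f x = a0" and y: "y \<in> space M" "f y = b0"
      and "velocity M k R\<^sub>1 (step_graphon f G) (x, y) = velocity M k R\<^sub>2 (step_graphon f G) (x, y)"
      using blocks ab0 m_pos \<open>0 < N\<close>
      by (elim AE_pair_obtains_point[of _ "{x \<in> space M. f x = a0}" "{x \<in> space M. f x = b0}"])
        (auto simp: prob)
    then have "0 = (\<Sum>X\<in>rooted_graphs k. D X * rooted_density M k X (step_graphon f G) (x, y))"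
      by (simp add: velocity_def D_def left_diff_distrib sum_subtractf)
    also have "\<dots> = (\<Sum>X\<in>rooted_graphs k. D X * (Q (m S) X / N ^ (k - 2)))"
    proof (intro sum.cong refl arg_cong2[where f=times])
      fix X assume X: "X \<in> rooted_graphs k"
      obtain F a b where X_eq: "X = (F, a, b)"
        by (metis prod.exhaust)
      have ab: "a \<in> {1..k}" "b \<in> {1..k}" "a \<noteq> b"
        using X by (auto simp: X_eq dest: rooted_graphsD)
      have "(\<Prod>i\<in>{1..k} - {a, b}. prob {x \<in> space M. f x = \<psi> i}) =
          (\<Prod>i\<in>{1..k} - {a, b}. m S (\<psi> i)) / N ^ (k - 2)" if "\<psi> \<in> E a b" for \<psi>
      proof -
        have "(\<Prod>i\<in>{1..k} - {a, b}. prob {x \<in> space M. f x = \<psi> i}) =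
            (\<Prod>i\<in>{1..k} - {a, b}. m S (\<psi> i) / N)"
          using PiE_mem[OF that[unfolded E_def]] by (intro prod.cong refl prob)
        then show ?thesis
          by (simp add: prod_dividef card_diff[OF ab])
      qed
      note densities = this
      have "rooted_density M k X (step_graphon f G) (x, y) =
          (\<Sum>\<psi>\<in>E a b. of_bool (F = pullback_graph k (\<psi>(a := a0, b := b0)) G) *
            (\<Prod>i\<in>{1..k} - {a, b}. prob {x \<in> space M. f x = \<psi> i}))"
        using rooted_density_step_graphon[OF f blocks X[unfolded X_eq] G x(1) y(1)]
        by (simp only: X_eq E_def x(2) y(2))
      also have "\<dots> = (\<Sum>\<psi>\<in>E a b. of_bool (F = pullback_graph k (\<psi>(a := a0, b := b0)) G) *
            ((\<Prod>i\<in>{1..k} - {a, b}. m S (\<psi> i)) / N ^ (k - 2)))"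
        by (intro sum.cong refl arg_cong2[where f=times] densities)
      also have "\<dots> = Q (m S) X / N ^ (k - 2)"
        by (simp add: Q_def X_eq sum_divide_distrib)
      finally show "rooted_density M k X (step_graphon f G) (x, y) = Q (m S) X / N ^ (k - 2)" .
    qed
    also have "\<dots> = (\<Sum>X\<in>rooted_graphs k. D X * Q (m S) X) / N ^ (k - 2)"
      by (simp add: sum_divide_distrib)
    finally show ?thesis
      using \<open>0 < N\<close> by simp
  qed
  \<comment> \<open>Summing over S first keeps only the \<psi> that are bijections onto B; those
    that also pull G back to F are the isomorphisms from X to X0.\<close>
  have alternate: "(\<Sum>S\<in>Pow B. (-1) ^ card S * Q (m S) X) = (-1) ^ card B * real (card (rooted_isos k X X0))"
    if X: "X \<in> rooted_graphs k" for X
  proof -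
    obtain F a b where X_eq: "X = (F, a, b)"
      by (metis prod.exhaust)
    have ab: "a \<in> {1..k}" "b \<in> {1..k}" "a \<noteq> b"
      using X by (auto simp: X_eq dest: rooted_graphsD)
    let ?I = "{1..k} - {a, b}"
    let ?p = "\<lambda>\<psi>. F = pullback_graph k (\<psi>(a := a0, b := b0)) G"
    have fin: "finite (E a b)"
      unfolding E_def by (rule finite_PiE) simp_all
    have "(\<Sum>S\<in>Pow B. (-1) ^ card S * Q (m S) X) =
        (\<Sum>S\<in>Pow B. \<Sum>\<psi>\<in>E a b. of_bool (?p \<psi>) * ((-1) ^ card S * (\<Prod>i\<in>?I. m S (\<psi> i))))"
      by (simp add: Q_def X_eq sum_distrib_left mult.left_commute)
    also have "\<dots> = (\<Sum>\<psi>\<in>E a b. of_bool (?p \<psi>) * (\<Sum>S\<in>Pow B. (-1) ^ card S * (\<Prod>i\<in>?I. m S (\<psi> i))))"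
      by (subst sum.swap) (simp add: sum_distrib_left)
    also have "\<dots> = (\<Sum>\<psi>\<in>E a b. of_bool (?p \<psi>) * ((-1) ^ card B * of_bool (bij_betw \<psi> ?I B)))"
      unfolding m_def
      by (subst alternating_sum_subsets) (auto simp: B_def card_diff[OF ab] card_diff[OF ab0])
    also have "\<dots> = (-1) ^ card B * (\<Sum>\<psi>\<in>E a b. of_bool (?p \<psi> \<and> bij_betw \<psi> ?I B))"
      by (simp add: sum_distrib_left of_bool_conj mult_ac)
    also have "(\<Sum>\<psi>\<in>E a b. of_bool (?p \<psi> \<and> bij_betw \<psi> ?I B)) =
        real (card {\<psi> \<in> E a b. ?p \<psi> \<and> bij_betw \<psi> ?I B})"
      using fin by (simp add: Int_def)
    also have "card {\<psi> \<in> E a b. ?p \<psi> \<and> bij_betw \<psi> ?I B} = card (rooted_isos k X X0)"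
      unfolding E_def B_def X_eq X0_eq
      by (rule card_root_fixing_bijections[OF X[unfolded X_eq] X0(1)[unfolded X0_eq]])
    finally show ?thesis .
  qed
  have "0 = (\<Sum>S\<in>Pow B. (-1) ^ card S * (\<Sum>X\<in>rooted_graphs k. D X * Q (m S) X))"
    by (simp add: vanish)
  also have "\<dots> = (\<Sum>X\<in>rooted_graphs k. D X * (\<Sum>S\<in>Pow B. (-1) ^ card S * Q (m S) X))"
    unfolding sum_distrib_left by (subst sum.swap) (simp add: mult.left_commute)
  also have "\<dots> = (-1) ^ card B * (\<Sum>X\<in>rooted_graphs k. D X * real (card (rooted_isos k X X0)))"
    by (simp add: alternate sum_distrib_left mult.left_commute)
  finally have "(\<Sum>X\<in>rooted_graphs k. D X * real (card (rooted_isos k X X0))) = 0"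
    by simp
  \<comment> \<open>Outside J there are no isomorphisms to X0, and within J their number is
    constant.\<close>
  also have "(\<Sum>X\<in>rooted_graphs k. D X * real (card (rooted_isos k X X0))) =
      (\<Sum>X\<in>J. D X * real (card (rooted_isos k X0 X0)))"
  proof (rule sum.mono_neutral_cong_right)
    show "J \<subseteq> rooted_graphs k"
      using X0(2) equiv_rooted_iso[of k] by (auto simp: rooted_iso_def)
    show "\<forall>X\<in>rooted_graphs k - J. D X * real (card (rooted_isos k X X0)) = 0"
    proof
      fix X assume X: "X \<in> rooted_graphs k - J"
      have "(X, X0) \<notin> rooted_iso k"
        using X X0(2) equiv_rooted_iso[of k] by (auto elim!: equivE dest: symD)
      then have "rooted_isos k X X0 = {}"
        using rooted_iso_if_rooted_isos X X0(1) by blast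
      then show "D X * real (card (rooted_isos k X X0)) = 0"
        by simp
    qed
    fix X assume "X \<in> J"
    then have "(X0, X) \<in> rooted_iso k"
      using X0(2) by simp
    then show "D X * real (card (rooted_isos k X X0)) = D X * real (card (rooted_isos k X0 X0))"
      using card_rooted_isos_cong by metis
  qed simp
  also have "\<dots> = (class_change k R\<^sub>1 J - class_change k R\<^sub>2 J) * real (card (rooted_isos k X0 X0))"
    by (simp add: class_change_def D_def sum_subtractf flip: sum_distrib_right)
  \<comment> \<open>The identity is an isomorphism from X0 to itself, so the common factor is
    nonzero and cancels.\<close>
  finally show ?thesis
    using rooted_isos_self[OF X0(1)] finite_rooted_isos[of k X0 X0] by (auto simp: card_eq_0_iff)
qed

end

theorem theorem1p3:
  fixes M :: "'a measure"
    and k :: nat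
    and R\<^sub>1 R\<^sub>2 :: "nat set set \<Rightarrow> nat set set \<Rightarrow> real"
  assumes "prob_space M" and "atomless M" and "separable_sigma_algebra M"
    and "k \<ge> 1"
    and "is_rule k R\<^sub>1" and "is_rule k R\<^sub>2"
  shows "(\<forall>J\<in>rooted_classes k. class_change k R\<^sub>1 J = class_change k R\<^sub>2 J) \<longleftrightarrow>
         (\<forall>W\<in>graphons M. \<forall>t\<ge>0. AE z in M \<Otimes>\<^sub>M M. flow M k R\<^sub>1 W t z = flow M k R\<^sub>2 W t z)"
proof -
  interpret prob_space M
    by fact
  show ?thesis
  proof
    assume "\<forall>J\<in>rooted_classes k. class_change k R\<^sub>1 J = class_change k R\<^sub>2 J"
    then have "flow M k R\<^sub>1 W = flow M k R\<^sub>2 W" for W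
      by (rule flow_eq_if_class_change_eq)
    then show "\<forall>W\<in>graphons M. \<forall>t\<ge>0. AE z in M \<Otimes>\<^sub>M M. flow M k R\<^sub>1 W t z = flow M k R\<^sub>2 W t z"
      by simp
  next
    assume "\<forall>W\<in>graphons M. \<forall>t\<ge>0. AE z in M \<Otimes>\<^sub>M M. flow M k R\<^sub>1 W t z = flow M k R\<^sub>2 W t z"
    then have "AE z in M \<Otimes>\<^sub>M M. velocity M k R\<^sub>1 W z = velocity M k R\<^sub>2 W z" if "W \<in> graphons M" for W
      using that assms(5,6) by (intro velocity_eq_if_flow_eq) auto
    then show "\<forall>J\<in>rooted_classes k. class_change k R\<^sub>1 J = class_change k R\<^sub>2 J"
      using class_change_eq_if_velocity_eq[OF \<open>atomless M\<close>] by blast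
  qed
qed

end
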